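(* Let $(h_n)_{n\in\mathbb N}$ be a complete orthonormal system of $\mathcal H$ that is an eigenbasis of $C_X$, let $\mathcal H^{(n)}=\operatorname{span}\{h_1,\dots,h_n\}$, let $\mathcal F=\mathcal G\oplus\mathcal H$, let $P^{(n)}\colon\mathcal F\to\mathcal F$ be the orthogonal projection onto $\mathcal G\oplus\mathcal H^{(n)}$, and let $${}^{u}C=\begin{pmatrix}{}^{u}C_Y&{}^{u}C_{YX}\\{}^{u}C_{XY}&{}^{u}C_X\end{pmatrix},\qquad {}^{u}C^{(n)}=P^{(n)}\,{}^{u}C\,P^{(n)}=\begin{pmatrix}{}^{u}C_Y&{}^{u}C_{YX}^{(n)}\\{}^{u}C_{XY}^{(n)}&{}^{u}C_X^{(n)}\end{pmatrix}.$$ Then $\operatorname{ran}{}^{u}C_{XY}^{(n)}\subseteq\operatorname{ran}{}^{u}C_X^{(n)}$ and therefore ${}^{u}h_g^{(n)}={}^{u}C_X^{(n)\dagger}\,{}^{u}C_{XY}^{(n)}g\in\mathcal H$ is well defined for each $g\in\mathcal G$. For each $y\in\mathcal Y$ and $h\in\mathcal H$, $$\langle h,\mu_{Y|X=\cdot}(y)\rangle_{L^2(\mathbb P_X)}=\lim_{n\to\infty}\langle h,{}^{u}\mu^{(n)}(\cdot,y)\rangle_{L^2(\mathbb P_X)},$$ where, for $x\in\mathcal X$ and $y\in\mathcal Y$, $${}^{u}\mu^{(n)}(x,y)=\big(({}^{u}C_X^{(n)\dagger}\,{}^{u}C_{XY}^{(n)})^{*}\varphi(x)\big)(y).$$ Suppose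 in addition that any one of the following four conditions holds: (i) the kernel $k$ is $L^2$-universal; (ii) $\mathcal H$ is dense in $L^2(\mathbb P_X)$; (iii) $f_g\in\overline{\mathcal H}^{L^2}$ for all $g\in\mathcal G$; (iv) $f_{\psi(y)}\in\overline{\mathcal H}^{L^2}$ for each $y\in\mathcal Y$. Then $$\big\|{}^{u}\mu^{(n)}(X,\cdot)-\mu_{Y|X}\big\|_{L^2(\mathbb P;\mathcal G)}\xrightarrow[n\to\infty]{}0.$$
   Context: Setting. $(\Omega,\Sigma,\mathbb P)$ is a probability space, $\mathcal X$ a measurable space, $\mathcal Y$ a Borel space (Borel isomorphic to a Borel subset of $[0,1]$). $k\colon\mathcal X\times\mathcal X\to\mathbb R$ and $\ell\colon\mathcal Y\times\mathcal Y\to\mathbb R$ are symmetric positive definite kernels such that $k(x,\cdot)$ and $\ell(y,\cdot)$ are Borel measurable for all $x,y$. $\mathcal H$ and $\mathcal G$ are the RKHSs of $k$ and $\ell$, assumed separable, with canonical feature maps $\varphi(x)=k(x,\cdot)\in\mathcal H$, $\psi(y)=\ell(y,\cdot)\in\mathcal G$. $X\colon\Omega\to\mathcal X$ and $Y\colon\Omega\to\mathcal Y$ are random variables with laws $\mathbb P_X,\mathbb P_Y$; $\mathbb P_{Y|X=x}$ is a fixed regular conditional distribution of $Y$ given $X=x$ (it exists and is $\mathbb P_X$-a.e. unique). Assume $\mathbb E[\|\varphi(X)\|_{\mathcal H}^2+\|\psi(Y)\|_{\mathcal G}^2]<\infty$. Then $\mathcal X_Y=\{x\in\mathcal X:\mathbb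 E[\|\psi(Y)\|_{\mathcal G}^2|X=x]<\infty\}$ has full $\mathbb P_X$-measure. Assume also that for $h\in\mathcal H$, $h=0$ $\mathbb P_X$-a.e. if and only if $h=0$; thus $\mathcal H$ is viewed as a subspace of $L^2(\mathbb P_X)$; $\overline{\mathcal H}^{L^2}$ is its closure in $L^2(\mathbb P_X)$. Covariances. Expectations of Hilbert-space-valued variables are Bochner integrals. For square-integrable $U,V$ with values in Hilbert spaces $\mathcal G,\mathcal H$, ${}^{u}\operatorname{Cov}[U,V]=\mathbb E[U\otimes V]$ and $\operatorname{Cov}[U,V]=\mathbb E[(U-\mathbb E U)\otimes(V-\mathbb E V)]$, operators $\mathcal H\to\mathcal G$, where $(g\otimes h)(h')=\langle h,h'\rangle g$. Set $C_X=\operatorname{Cov}[\varphi(X),\varphi(X)]$, ${}^{u}C_X={}^{u}\operatorname{Cov}[\varphi(X),\varphi(X)]$, ${}^{u}C_Y={}^{u}\operatorname{Cov}[\psi(Y),\psi(Y)]$, ${}^{u}C_{XY}={}^{u}\operatorname{Cov}[\varphi(X),\psi(Y)]\colon\mathcal G\to\mathcal H$, ${}^{u}C_{YX}=({}^{u}C_{XY})^{*}$. Conditional objects. $\mu_{Y|X=x}=\mathbb E[\psi(Y)|X=x]\in\mathcal G$ (integral of $\psi$ against $\mathbb P_{Y|X=x}$) for $x\in\mathcal X_Y$ and $\mu_{Y|X=x}=0$ otherwise; $\mu_{Y|X}$ is the $\mathcal G$-valued random variable obtained by inserting $x=X$. For $g\in\mathcal G$, $f_g(x)=\mathbb E[g(Y)|X=x]$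 for $x\in\mathcal X_Y$ and $f_g(x)=0$ otherwise; $f_g\in L^2(\mathbb P_X)$. The kernel $k$ is $L^2$-universal if it is Borel measurable and bounded and $\mathcal H$ is dense in $L^2(\mathbb Q)$ for every probability measure $\mathbb Q$ on $\mathcal X$. $A^{*}$ is the adjoint and $A^{\dagger}$ the Moore–Penrose pseudo-inverse of a bounded operator $A$ between Hilbert spaces: the linear extension of $(A|_{(\ker A)^\perp})^{-1}\colon\operatorname{ran}A\to(\ker A)^\perp$ to $\operatorname{dom}A^\dagger=\operatorname{ran}A\oplus(\operatorname{ran}A)^\perp$ with $\ker A^\dagger=(\operatorname{ran}A)^\perp$; ${}^{u}C_X^{(n)\dagger}$ means $({}^{u}C_X^{(n)})^{\dagger}$. *)

theory Defs
  imports "HOL-Probability.Probability" "HOL-Library.Extended_Nat"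
begin

definition sym_pd_kernel :: "'x set \<Rightarrow> ('x \<Rightarrow> 'x \<Rightarrow> real) \<Rightarrow> bool" where
  "sym_pd_kernel D k \<longleftrightarrow>
     (\<forall>x\<in>D. \<forall>y\<in>D. k x y = k y x) \<and>
     (\<forall>S a. finite S \<and> S \<subseteq> D \<longrightarrow> 0 \<le> (\<Sum>x\<in>S. \<Sum>y\<in>S. a x * a y * k x y))"

text \<open>A reproducing kernel Hilbert space of functions on D is a Hilbert space type 'h together
  with an evaluation map: eva f is the function on D that f "is". Elements are identified with
  functions on D (values of eva f outside D are irrelevant), so eva has to be linear and injective
  on D; the last clause says that k x belongs to the space and reproduces evaluation at x.\<close>
definition is_rkhs ::
  "'x set \<Rightarrow> ('x \<Rightarrow> 'x \<Rightarrow> real) \<Rightarrow> ('h::{real_inner, banach} \<Rightarrow> 'x \<Rightarrow> real) \<Rightarrow> bool" where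
  "is_rkhs D k eva \<longleftrightarrow>
     (\<forall>x\<in>D. linear (\<lambda>f. eva f x)) \<and>
     (\<forall>f g. (\<forall>x\<in>D. eva f x = eva g x) \<longrightarrow> f = g) \<and>
     (\<forall>x\<in>D. \<exists>p. (\<forall>y\<in>D. eva p y = k x y) \<and> (\<forall>f. inner f p = eva f x))"

definition feature_map ::
  "'x set \<Rightarrow> ('x \<Rightarrow> 'x \<Rightarrow> real) \<Rightarrow> ('h \<Rightarrow> 'x \<Rightarrow> real) \<Rightarrow> 'x \<Rightarrow> 'h" where
  "feature_map D k eva x = (THE p. \<forall>y\<in>D. eva p y = k x y)"

definition borel_space :: "'y measure \<Rightarrow> bool" where
  "borel_space N \<longleftrightarrow>
     (\<exists>B (f :: 'y \<Rightarrow> real). B \<in> sets borel \<and> B \<subseteq> {0..1} \<and> bij_betw f (space N) B \<and>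
        f \<in> measurable N (restrict_space borel B) \<and>
        inv_into (space N) f \<in> measurable (restrict_space borel B) N)"

definition regular_cond_distr ::
  "'w measure \<Rightarrow> 'x measure \<Rightarrow> ('w \<Rightarrow> 'x) \<Rightarrow> 'y measure \<Rightarrow> ('w \<Rightarrow> 'y) \<Rightarrow> ('x \<Rightarrow> 'y measure) \<Rightarrow> bool"
where
  "regular_cond_distr M MX X MY Y K \<longleftrightarrow>
     K \<in> measurable MX (prob_algebra MY) \<and>
     (\<forall>A\<in>sets MX. \<forall>B\<in>sets MY.
        emeasure M {\<omega>\<in>space M. X \<omega> \<in> A \<and> Y \<omega> \<in> B}
          = (\<integral>\<^sup>+x\<in>A. emeasure (K x) B \<partial>distr M MX X))"

definition L2_space ::
  "'a measure \<Rightarrow> ('a \<Rightarrow> 'b::{real_normed_vector, second_countable_topology}) set" where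
  "L2_space M = {f \<in> borel_measurable M. integrable M (\<lambda>x. (norm (f x))\<^sup>2)}"

definition L2_norm :: "'a measure \<Rightarrow> ('a \<Rightarrow> 'b::real_normed_vector) \<Rightarrow> real" where
  "L2_norm M f = sqrt (\<integral>x. (norm (f x))\<^sup>2 \<partial>M)"

definition L2_inner :: "'a measure \<Rightarrow> ('a \<Rightarrow> real) \<Rightarrow> ('a \<Rightarrow> real) \<Rightarrow> real" where
  "L2_inner M f g = (\<integral>x. f x * g x \<partial>M)"

definition L2_closure :: "'a measure \<Rightarrow> ('a \<Rightarrow> real) set \<Rightarrow> ('a \<Rightarrow> real) set" where
  "L2_closure M S =
     {f \<in> L2_space M. \<forall>e>0. \<exists>g \<in> S \<inter> L2_space M. L2_norm M (\<lambda>x. f x - g x) < e}"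

definition L2_dense :: "'a measure \<Rightarrow> ('a \<Rightarrow> real) set \<Rightarrow> bool" where
  "L2_dense M S \<longleftrightarrow> L2_closure M S = L2_space M"

definition L2_universal ::
  "'x measure \<Rightarrow> ('x \<Rightarrow> 'x \<Rightarrow> real) \<Rightarrow> ('h \<Rightarrow> 'x \<Rightarrow> real) \<Rightarrow> bool" where
  "L2_universal MX k eva \<longleftrightarrow>
     case_prod k \<in> borel_measurable (MX \<Otimes>\<^sub>M MX) \<and>
     (\<exists>B. \<forall>x\<in>space MX. \<forall>y\<in>space MX. \<bar>k x y\<bar> \<le> B) \<and>
     (\<forall>Q. prob_space Q \<and> sets Q = sets MX \<longrightarrow> L2_dense Q (range eva))"

text \<open>The library's Bochner integral is restricted to second countable types, which excludes
  spaces of bounded operators. This is the library's definition without that restriction; it is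
  used only for operator-valued integrands.\<close>
definition has_op_bochner_integral ::
  "'a measure \<Rightarrow> ('a \<Rightarrow> 'b::real_normed_vector) \<Rightarrow> 'b \<Rightarrow> bool" where
  "has_op_bochner_integral M f I \<longleftrightarrow>
     f \<in> borel_measurable M \<and>
     (\<exists>s. (\<forall>i. Bochner_Integration.simple_bochner_integrable M (s i)) \<and>
          (\<lambda>i. \<integral>\<^sup>+x. ennreal (norm (f x - s i x)) \<partial>M) \<longlonglongrightarrow> 0 \<and>
          (\<lambda>i. Bochner_Integration.simple_bochner_integral M (s i)) \<longlonglongrightarrow> I)"

definition op_bochner_integral :: "'a measure \<Rightarrow> ('a \<Rightarrow> 'b::real_normed_vector) \<Rightarrow> 'b" where
  "op_bochner_integral M f = (THE I. has_op_bochner_integral M f I)"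

definition tensor_op :: "'g::real_normed_vector \<Rightarrow> 'h::real_inner \<Rightarrow> 'h \<Rightarrow>\<^sub>L 'g" where
  "tensor_op g h = Blinfun (\<lambda>h'. inner h h' *\<^sub>R g)"

lemma tensor_op_apply: "blinfun_apply (tensor_op g h) h' = inner h h' *\<^sub>R g"
  unfolding tensor_op_def
  by (subst bounded_linear_Blinfun_apply)
     (auto intro: bounded_linear_compose[OF bounded_linear_scaleR_left bounded_linear_inner_right])

definition uncentred_cov ::
  "'w measure \<Rightarrow> ('w \<Rightarrow> 'g::real_normed_vector) \<Rightarrow> ('w \<Rightarrow> 'h::real_inner) \<Rightarrow> 'h \<Rightarrow>\<^sub>L 'g" where
  "uncentred_cov M U V = op_bochner_integral M (\<lambda>\<omega>. tensor_op (U \<omega>) (V \<omega>))"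

definition centred_cov ::
  "'w measure \<Rightarrow> ('w \<Rightarrow> 'g::{real_normed_vector, second_countable_topology}) \<Rightarrow>
     ('w \<Rightarrow> 'h::{real_inner, second_countable_topology}) \<Rightarrow> 'h \<Rightarrow>\<^sub>L 'g" where
  "centred_cov M U V =
     uncentred_cov M (\<lambda>\<omega>. U \<omega> - (\<integral>\<omega>'. U \<omega>' \<partial>M)) (\<lambda>\<omega>. V \<omega> - (\<integral>\<omega>'. V \<omega>' \<partial>M))"

definition orth_proj :: "'a::real_inner set \<Rightarrow> 'a \<Rightarrow> 'a" where
  "orth_proj S x = (THE p. p \<in> S \<and> x - p \<in> S\<^sup>\<bottom>)"

text \<open>The Moore-Penrose pseudo-inverse. The value at y = r + s with r in the range of A and s
  orthogonal to it is the preimage of r in the orthogonal complement of the kernel. Values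
  outside of the domain are meaningless.\<close>
definition pinv_dom :: "('a::real_inner \<Rightarrow> 'b::real_inner) \<Rightarrow> 'b set" where
  "pinv_dom A = {r + s | r s. r \<in> range A \<and> s \<in> (range A)\<^sup>\<bottom>}"

definition pinv :: "('a::real_inner \<Rightarrow> 'b::real_inner) \<Rightarrow> 'b \<Rightarrow> 'a" where
  "pinv A y = inv_into ({x. A x = 0}\<^sup>\<bottom>) A (THE r. r \<in> range A \<and> y - r \<in> (range A)\<^sup>\<bottom>)"

definition block_op ::
  "('g::real_vector \<Rightarrow> 'g) \<Rightarrow> ('h::real_vector \<Rightarrow> 'g) \<Rightarrow> ('g \<Rightarrow> 'h) \<Rightarrow> ('h \<Rightarrow> 'h) \<Rightarrow>
     'g \<times> 'h \<Rightarrow> 'g \<times> 'h" where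
  "block_op A B C D = (\<lambda>(g, h). (A g + B h, C g + D h))"

definition complete_orthonormal_on :: "'i set \<Rightarrow> ('i \<Rightarrow> 'h::real_inner) \<Rightarrow> bool" where
  "complete_orthonormal_on J h \<longleftrightarrow>
     (\<forall>i\<in>J. \<forall>j\<in>J. inner (h i) (h j) = (if i = j then 1 else 0)) \<and>
     closure (span (h ` J)) = UNIV"

definition eigenbasis_on :: "'i set \<Rightarrow> ('i \<Rightarrow> 'h::real_inner) \<Rightarrow> ('h \<Rightarrow> 'h) \<Rightarrow> bool" where
  "eigenbasis_on J h A \<longleftrightarrow>
     complete_orthonormal_on J h \<and> (\<forall>i\<in>J. \<exists>c. A (h i) = c *\<^sub>R h i)"

definition finite_cond_moment ::
  "'x measure \<Rightarrow> ('x \<Rightarrow> 'y measure) \<Rightarrow> ('y \<Rightarrow> 'g::real_normed_vector) \<Rightarrow> 'x set" where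
  "finite_cond_moment MX K psi =
     {x \<in> space MX. (\<integral>\<^sup>+y. ennreal ((norm (psi y))\<^sup>2) \<partial>K x) < \<infinity>}"

definition cond_mean_embedding ::
  "'x measure \<Rightarrow> ('x \<Rightarrow> 'y measure) \<Rightarrow>
     ('y \<Rightarrow> 'g::{real_normed_vector, second_countable_topology}) \<Rightarrow> 'x \<Rightarrow> 'g" where
  "cond_mean_embedding MX K psi x =
     (if x \<in> finite_cond_moment MX K psi then \<integral>y. psi y \<partial>K x else 0)"

definition cond_exp_fun ::
  "'x measure \<Rightarrow> ('x \<Rightarrow> 'y measure) \<Rightarrow> ('y \<Rightarrow> 'g::real_normed_vector) \<Rightarrow>
     ('g \<Rightarrow> 'y \<Rightarrow> real) \<Rightarrow> 'g \<Rightarrow> 'x \<Rightarrow> real" where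
  "cond_exp_fun MX K psi eva g x =
     (if x \<in> finite_cond_moment MX K psi then \<integral>y. eva g y \<partial>K x else 0)"

end

theory Submission
  imports Defs
begin

text \<open>
Write \<open>inner u \<circ> phi\<close> for the function \<open>x \<mapsto> inner u (phi x)\<close>; by the reproducing property it is the
function that \<open>u \<in> \<H>\<close> stands for. The uncentred covariances are Gram operators:
\<open>inner v (uCX u)\<close> is the \<open>L\<^sup>2\<close> inner product of \<open>inner v \<circ> phi\<close> and \<open>inner u \<circ> phi\<close>, and, after
conditioning on \<open>X\<close>, \<open>inner v (uCXY g)\<close> is that of \<open>inner v \<circ> phi\<close> and \<open>inner g \<circ> mu\<close>
(\<open>inner_CX\<close>, \<open>inner_CXY\<close>). The operator \<open>uCX\<close> is definite because only the zero element of \<open>\<H>\<close> vanishes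
almost everywhere. Hence its compression to the finite-dimensional space \<open>Hn n\<close> is a bijection of
\<open>Hn n\<close>, which contains the range of the compressed cross-covariance, and the pseudo-inverse solves the
compressed normal equation. That equation says that \<open>uh n g\<close> represents the \<open>L\<^sup>2\<close>-projection
of \<open>inner g \<circ> mu\<close> onto the functions in \<open>Hn n\<close>.

Transposing, \<open>umu n\<close> is the projection of the \<open>\<G>\<close>-valued function \<open>mu\<close> onto \<open>\<G> \<otimes> Hn n\<close> in
\<open>L\<^sup>2\<close> (\<open>residual_orthogonal\<close>, \<open>adjoint_R_expansion\<close>). Both convergence statements are properties of
such projections. Orthogonality of the residual to \<open>Hn n\<close> gives convergence against every
element of \<open>\<H>\<close>, because the spaces \<open>Hn n\<close> increase to a dense subspace of \<open>\<H>\<close>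
(\<open>weak_convergence\<close>). If every \<open>inner g \<circ> mu\<close> is an \<open>L\<^sup>2\<close>-limit of functions in \<open>\<H>\<close>, then
\<open>mu\<close> is a limit of elements of the spaces \<open>\<G> \<otimes> Hn n\<close>, and best approximation gives convergence in norm
(\<open>strong_convergence\<close>). Each of the four conditions supplies these limits for \<open>g = psi y\<close>, and the
functions \<open>psi y\<close> span a dense subspace of \<open>\<G>\<close> (\<open>L2_approximable_all_if_dense\<close>).

The analytic prerequisites are that the covariance operators exist as operator-valued integrals
(\<open>has_op_bochner_integral_tensor_op_exists\<close>), that the feature maps are measurable
(\<open>feature_map_measurable\<close>), and that integrals over the joint law disintegrate along the regular
conditional distribution (\<open>integral_disintegration\<close>).\<close>

section \<open>Dense subspaces and measurability in separable Hilbert spaces\<close>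

text \<open>The projection theorem in the form used for density: a sequence in \<open>S\<close> whose distances to
\<open>x\<close> tend to the infimum is Cauchy by the parallelogram identity, its limit \<open>p\<close> lies in the
closure, and minimality of \<open>p\<close> makes \<open>x - p\<close> orthogonal to \<open>S\<close>, hence zero.\<close>

lemma closure_subspace_UNIV_if_orthogonal_trivial:
  fixes S :: "'h::{real_inner, banach} set"
  assumes S: "subspace S"
    and triv: "\<And>u. (\<And>s. s \<in> S \<Longrightarrow> inner u s = 0) \<Longrightarrow> u = 0"
  shows "closure S = UNIV"
proof -
  have "x \<in> closure S" for x
  proof -
    define A where "A = (\<lambda>s. (norm (x - s))\<^sup>2) ` S"
    define d where "d = Inf A"
    have S0: "0 \<in> S" using S by (rule subspace_0)
    have ne: "A \<noteq> {}" using S0 by (auto simp: A_def)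
    have bdd: "bdd_below A" unfolding A_def by (rule bdd_belowI[of _ 0]) auto
    have d_le: "d \<le> (norm (x - s))\<^sup>2" if "s \<in> S" for s
      unfolding d_def using bdd that by (intro cInf_lower) (auto simp: A_def)
    have "\<exists>s\<in>S. (norm (x - s))\<^sup>2 < d + inverse (real (Suc n))" for n
    proof -
      have "\<exists>a\<in>A. a < d + inverse (real (Suc n))"
        using ne by (intro cInf_lessD) (auto simp: d_def)
      then show ?thesis by (auto simp: A_def)
    qed
    then obtain s where s: "\<And>n. s n \<in> S" "\<And>n. (norm (x - s n))\<^sup>2 < d + inverse (real (Suc n))"
      by metis
    have par: "(norm (s m - s n))\<^sup>2 \<le> 2 * inverse (real (Suc m)) + 2 * inverse (real (Suc n))" for m n
    proof -
      have "(norm (s m - s n))\<^sup>2 = 2 * (norm (x - s m))\<^sup>2 + 2 * (norm (x - s n))\<^sup>2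
          - 4 * (norm (x - (1/2) *\<^sub>R (s m + s n)))\<^sup>2"
        by (simp add: power2_norm_eq_inner inner_simps inner_commute algebra_simps)
      moreover have "d \<le> (norm (x - (1/2) *\<^sub>R (s m + s n)))\<^sup>2"
        by (intro d_le subspace_scale[OF S] subspace_add[OF S] s)
      ultimately show ?thesis using s(2)[of m] s(2)[of n] by linarith
    qed
    have "Cauchy s"
    proof (rule metric_CauchyI)
      fix e :: real assume e: "e > 0"
      obtain N where N: "inverse (real (Suc N)) < e\<^sup>2 / 4"
        using reals_Archimedean[of "e\<^sup>2 / 4"] e by auto
      have "dist (s m) (s n) < e" if "m \<ge> N" "n \<ge> N" for m n
      proof -
        have "inverse (real (Suc m)) \<le> inverse (real (Suc N))" "inverse (real (Suc n)) \<le> inverse (real (Suc N))"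
          using that by (auto intro!: le_imp_inverse_le)
        then have "(norm (s m - s n))\<^sup>2 < e\<^sup>2" using par[of m n] N by linarith
        then show ?thesis using e by (simp add: dist_norm power2_less_imp_less)
      qed
      then show "\<exists>N. \<forall>m\<ge>N. \<forall>n\<ge>N. dist (s m) (s n) < e" by blast
    qed
    then obtain p where p: "s \<longlonglongrightarrow> p" using Cauchy_convergent_iff convergent_def by blast
    have pS: "p \<in> closure S" using s(1) p closure_sequential by blast
    have pd: "(norm (x - p))\<^sup>2 \<le> d"
    proof (rule LIMSEQ_le)
      show "(\<lambda>n. (norm (x - s n))\<^sup>2) \<longlonglongrightarrow> (norm (x - p))\<^sup>2" by (intro tendsto_intros p)
      show "(\<lambda>n. d + inverse (real (Suc n))) \<longlonglongrightarrow> d"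
        using tendsto_add[OF tendsto_const LIMSEQ_inverse_real_of_nat, of d] by simp
      show "\<exists>N. \<forall>n\<ge>N. (norm (x - s n))\<^sup>2 \<le> d + inverse (real (Suc n))"
        using s(2) by (auto intro!: less_imp_le)
    qed
    have d_le': "d \<le> (norm (x - p - q))\<^sup>2" if "q \<in> S" for q
    proof (rule LIMSEQ_le_const)
      show "(\<lambda>n. (norm (x - s n - q))\<^sup>2) \<longlonglongrightarrow> (norm (x - p - q))\<^sup>2" by (intro tendsto_intros p)
      have "d \<le> (norm (x - s n - q))\<^sup>2" for n
        using d_le[OF subspace_add[OF S s(1)[of n] that]] by (simp add: algebra_simps)
      then show "\<exists>N. \<forall>n\<ge>N. d \<le> (norm (x - s n - q))\<^sup>2" by auto
    qed
    have "inner (x - p) q = 0" if q: "q \<in> S" for q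
    proof (rule ccontr)
      assume nz: "inner (x - p) q \<noteq> 0"
      then have q0: "inner q q > 0" by auto
      \<comment> \<open>The minimiser of the parabola that maps \<open>t\<close> to the squared norm of \<open>x - p - t q\<close>.\<close>
      define t where "t = inner (x - p) q / inner q q"
      have "(norm (x - p))\<^sup>2 \<le> (norm (x - p - t *\<^sub>R q))\<^sup>2"
        using d_le'[OF subspace_scale[OF S q, of t]] pd by linarith
      also have "\<dots> = (norm (x - p))\<^sup>2 - 2 * t * inner (x - p) q + t\<^sup>2 * inner q q"
        by (simp add: power2_norm_eq_inner inner_simps inner_commute algebra_simps power2_eq_square[of t])
      also have "\<dots> = (norm (x - p))\<^sup>2 - (inner (x - p) q)\<^sup>2 / inner q q"
        using q0 by (simp add: t_def power2_eq_square)
      finally show False using nz q0 by (simp add: field_simps not_le)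
    qed
    then have "x - p = 0" by (rule triv)
    then show ?thesis using pS by simp
  qed
  then show ?thesis by auto
qed

lemma measurable_inner_if_dense:
  fixes f :: "'a \<Rightarrow> 'b::real_inner"
  assumes dense: "closure (span B) = UNIV"
    and meas: "\<And>b. b \<in> B \<Longrightarrow> (\<lambda>x. inner b (f x)) \<in> borel_measurable M"
  shows "(\<lambda>x. inner u (f x)) \<in> borel_measurable M"
proof -
  have span: "(\<lambda>x. inner v (f x)) \<in> borel_measurable M" if "v \<in> span B" for v
    using that
  proof (induction rule: span_induct_alt)
    case base then show ?case by simp
  next
    case (step c b y)
    then show ?case using meas[of b] by (simp add: inner_add_left)
  qed
  have "u \<in> closure (span B)" using dense by simp
  then obtain v where v: "\<And>n. v n \<in> span B" "v \<longlonglongrightarrow> u" by (auto simp: closure_sequential)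
  show ?thesis
  proof (rule borel_measurable_LIMSEQ_real)
    show "(\<lambda>n. inner (v n) (f x)) \<longlonglongrightarrow> inner u (f x)" for x by (intro tendsto_intros v)
    show "(\<lambda>x. inner (v n) (f x)) \<in> borel_measurable M" for n by (rule span[OF v(1)])
  qed
qed

text \<open>Pettis' measurability theorem for a separable inner product space. Open sets are countable unions
of closed balls, and membership in a closed ball is a countable conjunction of conditions on inner
products, because a bound \<open>inner e y \<le> r * norm e\<close> that holds on a dense set extends to
\<open>e = y\<close>.\<close>

lemma borel_measurable_if_weakly_measurable:
  fixes f :: "'a \<Rightarrow> 'b::{real_inner, second_countable_topology}"
  assumes weak: "\<And>u. (\<lambda>x. inner u (f x)) \<in> borel_measurable M"
  shows "f \<in> borel_measurable M"
proof -
  obtain D :: "'b set" where cD: "countable D" and D: "\<And>X. open X \<Longrightarrow> X \<noteq> {} \<Longrightarrow> \<exists>d\<in>D. d \<in> X"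
    by (erule countable_dense_setE)
  have norm_le: "norm y \<le> r \<longleftrightarrow> (\<forall>e\<in>D. inner e y \<le> r * norm e)" if "r \<ge> 0" for y :: 'b and r
  proof
    assume "norm y \<le> r"
    then show "\<forall>e\<in>D. inner e y \<le> r * norm e"
      by (metis mult.commute mult_left_mono norm_cauchy_schwarz norm_ge_zero order_trans)
  next
    assume *: "\<forall>e\<in>D. inner e y \<le> r * norm e"
    have "inner y y \<le> r * norm y"
    proof (rule ccontr)
      assume "\<not> inner y y \<le> r * norm y"
      then have "y \<in> {e. r * norm e < inner e y}" by auto
      moreover have "open {e. r * norm e < inner e y}"
        by (intro open_Collect_less continuous_intros)
      ultimately obtain e where "e \<in> D" "r * norm e < inner e y" using D by blast
      then show False using * by force
    qed
    then have "norm y * norm y \<le> r * norm y"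
      by (metis power2_eq_square power2_norm_eq_inner)
    then show "norm y \<le> r" using that by (cases "y = 0") auto
  qed
  show ?thesis
  proof (rule borel_measurableI)
    fix S :: "'b set" assume S: "open S"
    define I where "I = {(a, r). a \<in> D \<and> r \<in> \<rat> \<and> r \<ge> 0 \<and> cball a r \<subseteq> S}"
    have cI: "countable I"
      by (rule countable_subset[OF _ countable_SIGMA[OF cD countable_rat]]) (auto simp: I_def)
    have cov: "\<exists>(a, r)\<in>I. z \<in> cball a r" if z: "z \<in> S" for z
    proof -
      obtain e where e: "e > 0" "ball z e \<subseteq> S" using S z openE by blast
      obtain q where q: "q \<in> \<rat>" "0 < q" "q < e / 2" using Rats_dense_in_real[of 0 "e/2"] e by auto
      obtain a where a: "a \<in> D" "a \<in> ball z q" using D[of "ball z q"] q by auto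
      have "cball a q \<subseteq> ball z e"
      proof
        fix w assume "w \<in> cball a q"
        then show "w \<in> ball z e" using dist_triangle[of z w a] a q by (auto simp: dist_commute)
      qed
      then show ?thesis using a q e by (intro bexI[of _ "(a, q)"]) (auto simp: I_def dist_commute)
    qed
    have "f -` S \<inter> space M = (\<Union>(a, r)\<in>I. {x\<in>space M. f x \<in> cball a r})"
      using cov by (fastforce simp: I_def)
    also have "\<dots> = (\<Union>(a, r)\<in>I. {x\<in>space M. \<forall>e\<in>D. inner e (f x) - inner e a \<le> r * norm e})"
    proof (intro SUP_cong refl)
      fix p assume p: "p \<in> I"
      obtain a r where [simp]: "p = (a, r)" by (cases p)
      have "f x \<in> cball a r \<longleftrightarrow> (\<forall>e\<in>D. inner e (f x) - inner e a \<le> r * norm e)" for x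
        using norm_le[of r "f x - a"] p
        by (simp add: I_def dist_norm norm_minus_commute inner_diff_right)
      then show "(case p of (a, r) \<Rightarrow> {x\<in>space M. f x \<in> cball a r}) =
          (case p of (a, r) \<Rightarrow> {x\<in>space M. \<forall>e\<in>D. inner e (f x) - inner e a \<le> r * norm e})" by simp
    qed
    also have "\<dots> \<in> sets M"
    proof (intro sets.countable_UN' cI, safe)
      fix a r
      note [measurable] = weak
      have meas: "{x\<in>space M. r * norm e < inner e (f x) - inner e a} \<in> sets M" for e by measurable
      have "{x\<in>space M. \<forall>e\<in>D. inner e (f x) - inner e a \<le> r * norm e} =
          space M - (\<Union>e\<in>D. {x\<in>space M. r * norm e < inner e (f x) - inner e a})"
        by (auto simp: not_less)
      also have "\<dots> \<in> sets M"
        using meas by (intro sets.Diff sets.top sets.countable_UN' cD) auto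
      finally show "{x\<in>space M. \<forall>e\<in>D. inner e (f x) - inner e a \<le> r * norm e} \<in> sets M" .
    qed
    finally show "f -` S \<inter> space M \<in> sets M" .
  qed
qed

section \<open>Square-integrable functions with values in a Hilbert space\<close>

lemma L2_spaceD:
  assumes "f \<in> L2_space M"
  shows "f \<in> borel_measurable M" "integrable M (\<lambda>x. (norm (f x))\<^sup>2)"
  using assms by (auto simp: L2_space_def)

lemma L2_space_if_norm_le:
  assumes g: "g \<in> L2_space M" and f: "f \<in> borel_measurable M"
    and le: "\<And>x. x \<in> space M \<Longrightarrow> norm (f x) \<le> c * norm (g x)"
  shows "f \<in> L2_space M"
proof -
  have "integrable M (\<lambda>x. (norm (f x))\<^sup>2)"
  proof (rule Bochner_Integration.integrable_bound)
    show "integrable M (\<lambda>x. c\<^sup>2 * (norm (g x))\<^sup>2)" using L2_spaceD[OF g] by simp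
    show "(\<lambda>x. (norm (f x))\<^sup>2) \<in> borel_measurable M" using f by simp
    show "AE x in M. norm ((norm (f x))\<^sup>2) \<le> norm (c\<^sup>2 * (norm (g x))\<^sup>2)"
    proof (rule AE_I2)
      fix x assume "x \<in> space M"
      then have "(norm (f x))\<^sup>2 \<le> (c * norm (g x))\<^sup>2" by (intro power_mono le) auto
      then show "norm ((norm (f x))\<^sup>2) \<le> norm (c\<^sup>2 * (norm (g x))\<^sup>2)"
        by (simp add: power_mult_distrib)
    qed
  qed
  then show ?thesis using f by (simp add: L2_space_def)
qed

lemma L2_space_cong:
  "(\<And>x. x \<in> space M \<Longrightarrow> f x = g x) \<Longrightarrow> f \<in> L2_space M \<longleftrightarrow> g \<in> L2_space M"
  unfolding L2_space_def
  by (simp cong: measurable_cong_simp Bochner_Integration.integrable_cong)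

lemma L2_norm_cong:
  "(\<And>x. x \<in> space M \<Longrightarrow> f x = g x) \<Longrightarrow> L2_norm M f = L2_norm M g"
  unfolding L2_norm_def by (simp cong: Bochner_Integration.integral_cong)

lemma L2_norm_nonneg [simp]: "0 \<le> L2_norm M f"
  by (simp add: L2_norm_def)

lemma L2_norm_power2: "(L2_norm M f)\<^sup>2 = (\<integral>x. (norm (f x))\<^sup>2 \<partial>M)"
  by (simp add: L2_norm_def)

lemma L2_space_scaleR: "f \<in> L2_space M \<Longrightarrow> (\<lambda>x. c *\<^sub>R f x) \<in> L2_space M"
  by (rule L2_space_if_norm_le[where c = "\<bar>c\<bar>"]) (auto dest: L2_spaceD)

lemma L2_space_zero [simp]: "(\<lambda>x. 0) \<in> L2_space M"
  by (simp add: L2_space_def)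

lemma L2_space_add:
  fixes f g :: "'a \<Rightarrow> 'b::{real_normed_vector, second_countable_topology}"
  assumes f: "f \<in> L2_space M" and g: "g \<in> L2_space M"
  shows "(\<lambda>x. f x + g x) \<in> L2_space M"
proof -
  note [measurable] = L2_spaceD(1)[OF f] L2_spaceD(1)[OF g]
  have "integrable M (\<lambda>x. (norm (f x + g x))\<^sup>2)"
  proof (rule Bochner_Integration.integrable_bound)
    show "integrable M (\<lambda>x. 2 * (norm (f x))\<^sup>2 + 2 * (norm (g x))\<^sup>2)"
      using L2_spaceD[OF f] L2_spaceD[OF g] by simp
    have "(norm (f x + g x))\<^sup>2 \<le> 2 * (norm (f x))\<^sup>2 + 2 * (norm (g x))\<^sup>2" for x
    proof -
      have "(norm (f x + g x))\<^sup>2 \<le> (norm (f x) + norm (g x))\<^sup>2"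
        by (intro power_mono norm_triangle_ineq) simp
      moreover have "0 \<le> (norm (f x) - norm (g x))\<^sup>2" by simp
      ultimately show ?thesis by (simp add: power2_eq_square algebra_simps)
    qed
    then show "AE x in M. norm ((norm (f x + g x))\<^sup>2) \<le> norm (2 * (norm (f x))\<^sup>2 + 2 * (norm (g x))\<^sup>2)"
      by auto
  qed measurable
  then show ?thesis by (simp add: L2_space_def)
qed

lemma L2_space_diff:
  fixes f g :: "'a \<Rightarrow> 'b::{real_normed_vector, second_countable_topology}"
  shows "f \<in> L2_space M \<Longrightarrow> g \<in> L2_space M \<Longrightarrow> (\<lambda>x. f x - g x) \<in> L2_space M"
  using L2_space_add[of f M "\<lambda>x. (-1) *\<^sub>R g x"] L2_space_scaleR[of g M "-1"] by simp

lemma L2_space_sum: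
  fixes f :: "'i \<Rightarrow> 'a \<Rightarrow> 'b::{real_normed_vector, second_countable_topology}"
  shows "(\<And>i. i \<in> I \<Longrightarrow> f i \<in> L2_space M) \<Longrightarrow> (\<lambda>x. \<Sum>i\<in>I. f i x) \<in> L2_space M"
  by (induction I rule: infinite_finite_induct) (auto intro: L2_space_add)

lemma L2_space_inner:
  fixes f :: "'a \<Rightarrow> 'b::{real_inner, second_countable_topology}"
  assumes f: "f \<in> L2_space M"
  shows "(\<lambda>x. inner u (f x)) \<in> L2_space M" "L2_norm M (\<lambda>x. inner u (f x)) \<le> norm u * L2_norm M f"
proof -
  have meas: "(\<lambda>x. inner u (f x)) \<in> borel_measurable M" using L2_spaceD(1)[OF f] by simp
  have le: "norm (inner u (f x)) \<le> norm u * norm (f x)" for x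
    by (simp add: Cauchy_Schwarz_ineq2)
  show "(\<lambda>x. inner u (f x)) \<in> L2_space M" by (rule L2_space_if_norm_le[OF f meas le])
  show "L2_norm M (\<lambda>x. inner u (f x)) \<le> norm u * L2_norm M f"
  proof -
    have "(L2_norm M (\<lambda>x. inner u (f x)))\<^sup>2 \<le> (norm u * L2_norm M f)\<^sup>2"
      unfolding L2_norm_power2 power_mult_distrib integral_mult_right_zero[symmetric]
    proof (rule integral_mono)
      show "integrable M (\<lambda>x. (norm (inner u (f x)))\<^sup>2)"
        by (rule L2_spaceD(2)[OF L2_space_if_norm_le[OF f meas le]])
      show "integrable M (\<lambda>x. (norm u)\<^sup>2 * (norm (f x))\<^sup>2)" using L2_spaceD(2)[OF f] by simp
      show "(norm (inner u (f x)))\<^sup>2 \<le> (norm u)\<^sup>2 * (norm (f x))\<^sup>2" for x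
        using power_mono[OF le, of x 2] by (simp add: power_mult_distrib)
    qed
    then show ?thesis by (rule power2_le_imp_le) simp
  qed
qed

lemma L2_integrable_norm_mult:
  assumes f: "f \<in> L2_space M" and g: "g \<in> L2_space M"
  shows "integrable M (\<lambda>x. norm (f x) * norm (g x))"
proof (rule Bochner_Integration.integrable_bound)
  note [measurable] = L2_spaceD(1)[OF f] L2_spaceD(1)[OF g]
  show "integrable M (\<lambda>x. (norm (f x))\<^sup>2 + (norm (g x))\<^sup>2)"
    using L2_spaceD[OF f] L2_spaceD[OF g] by simp
  show "(\<lambda>x. norm (f x) * norm (g x)) \<in> borel_measurable M" by measurable
  show "AE x in M. norm (norm (f x) * norm (g x)) \<le> norm ((norm (f x))\<^sup>2 + (norm (g x))\<^sup>2)"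
  proof (rule AE_I2)
    fix x
    have "0 \<le> (norm (f x) - norm (g x))\<^sup>2" by simp
    moreover have "0 \<le> norm (f x) * norm (g x)" by simp
    ultimately have "norm (f x) * norm (g x) \<le> (norm (f x))\<^sup>2 + (norm (g x))\<^sup>2"
      unfolding power2_diff mult.assoc by linarith
    then show "norm (norm (f x) * norm (g x)) \<le> norm ((norm (f x))\<^sup>2 + (norm (g x))\<^sup>2)"
      by simp
  qed
qed

lemma L2_integrable_inner:
  fixes f g :: "'a \<Rightarrow> 'b::{real_inner, second_countable_topology}"
  assumes f: "f \<in> L2_space M" and g: "g \<in> L2_space M"
  shows "integrable M (\<lambda>x. inner (f x) (g x))"
proof (rule Bochner_Integration.integrable_bound[OF L2_integrable_norm_mult[OF f g]])
  note [measurable] = L2_spaceD(1)[OF f] L2_spaceD(1)[OF g]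
  show "(\<lambda>x. inner (f x) (g x)) \<in> borel_measurable M" by measurable
qed (simp add: Cauchy_Schwarz_ineq2)

lemma L2_integrable_mult:
  fixes f g :: "'a \<Rightarrow> real"
  shows "f \<in> L2_space M \<Longrightarrow> g \<in> L2_space M \<Longrightarrow> integrable M (\<lambda>x. f x * g x)"
  using L2_integrable_inner[of f M g] by simp

lemma L2_norm_add_power2:
  fixes f g :: "'a \<Rightarrow> 'b::{real_inner, second_countable_topology}"
  assumes f: "f \<in> L2_space M" and g: "g \<in> L2_space M"
  shows "(L2_norm M (\<lambda>x. f x + g x))\<^sup>2 =
    (L2_norm M f)\<^sup>2 + 2 * (\<integral>x. inner (f x) (g x) \<partial>M) + (L2_norm M g)\<^sup>2"
proof -
  have "(norm (f x + g x))\<^sup>2 = (norm (f x))\<^sup>2 + 2 * inner (f x) (g x) + (norm (g x))\<^sup>2" for x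
    by (simp add: power2_norm_eq_inner inner_simps inner_commute)
  then show ?thesis
    using L2_spaceD(2)[OF f] L2_spaceD(2)[OF g] L2_integrable_inner[OF f g]
    by (simp add: L2_norm_power2)
qed

lemma L2_norm_scaleR: "L2_norm M (\<lambda>x. c *\<^sub>R f x) = \<bar>c\<bar> * L2_norm M f"
  by (simp add: L2_norm_def power_mult_distrib real_sqrt_mult)

text \<open>The quadratic \<open>t \<mapsto> (L2_norm M (f + t g))\<^sup>2\<close> is nonnegative, so its discriminant is not positive.
If \<open>L2_norm M g\<close> is zero, the quadratic is affine, and it is bounded below only if its slope is zero.\<close>

lemma L2_Cauchy_Schwarz:
  fixes f g :: "'a \<Rightarrow> 'b::{real_inner, second_countable_topology}"
  assumes f: "f \<in> L2_space M" and g: "g \<in> L2_space M"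
  shows "\<bar>\<integral>x. inner (f x) (g x) \<partial>M\<bar> \<le> L2_norm M f * L2_norm M g"
proof -
  define b where "b = (\<integral>x. inner (f x) (g x) \<partial>M)"
  have nonneg: "0 \<le> (L2_norm M f)\<^sup>2 + 2 * t * b + t\<^sup>2 * (L2_norm M g)\<^sup>2" for t
    using L2_norm_add_power2[OF f L2_space_scaleR[OF g, of t]]
    zero_le_power2[of "L2_norm M (\<lambda>x. f x + t *\<^sub>R g x)"]
    by (simp add: L2_norm_scaleR power_mult_distrib b_def mult.assoc)
  have "b\<^sup>2 \<le> (L2_norm M f)\<^sup>2 * (L2_norm M g)\<^sup>2"
  proof (cases "L2_norm M g = 0")
    case True
    have "b = 0"
    proof (rule ccontr)
      assume "b \<noteq> 0"
      \<comment> \<open>At this \<open>t\<close> the affine function takes the value \<open>-1\<close>.\<close>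
      then have "2 * (- ((L2_norm M f)\<^sup>2 + 1) / (2 * b)) * b = - ((L2_norm M f)\<^sup>2 + 1)" by simp
      then show False
        using nonneg[of "- ((L2_norm M f)\<^sup>2 + 1) / (2 * b)"] True by simp
    qed
    then show ?thesis by simp
  next
    case False
    then have c: "(L2_norm M g)\<^sup>2 > 0" by simp
    have "2 * (- b / c) * b + (- b / c)\<^sup>2 * c = - (b\<^sup>2 / c)" for c :: real
      by (simp add: power2_eq_square)
    from this[of "(L2_norm M g)\<^sup>2"] nonneg[of "- b / (L2_norm M g)\<^sup>2"]
    have "0 \<le> (L2_norm M f)\<^sup>2 - b\<^sup>2 / (L2_norm M g)\<^sup>2" by linarith
    then show ?thesis using c by (simp add: field_simps)
  qed
  then have "\<bar>b\<bar>\<^sup>2 \<le> (L2_norm M f * L2_norm M g)\<^sup>2" by (simp add: power_mult_distrib)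
  then show ?thesis unfolding b_def by (rule power2_le_imp_le) simp
qed

lemma L2_norm_triangle:
  fixes f g :: "'a \<Rightarrow> 'b::{real_inner, second_countable_topology}"
  assumes f: "f \<in> L2_space M" and g: "g \<in> L2_space M"
  shows "L2_norm M (\<lambda>x. f x + g x) \<le> L2_norm M f + L2_norm M g"
proof (rule power2_le_imp_le)
  show "(L2_norm M (\<lambda>x. f x + g x))\<^sup>2 \<le> (L2_norm M f + L2_norm M g)\<^sup>2"
    using L2_norm_add_power2[OF f g] L2_Cauchy_Schwarz[OF f g]
    by (simp add: power2_eq_square algebra_simps)
qed simp

lemma L2_norm_triangle_diff:
  fixes f g k :: "'a \<Rightarrow> 'b::{real_inner, second_countable_topology}"
  assumes "f \<in> L2_space M" "g \<in> L2_space M" "k \<in> L2_space M"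
  shows "L2_norm M (\<lambda>x. f x - k x) \<le> L2_norm M (\<lambda>x. f x - g x) + L2_norm M (\<lambda>x. g x - k x)"
  using L2_norm_triangle[OF L2_space_diff[OF assms(1,2)] L2_space_diff[OF assms(2,3)]] by simp

lemma L2_norm_sum_le:
  fixes f :: "'i \<Rightarrow> 'a \<Rightarrow> 'b::{real_inner, second_countable_topology}"
  assumes "\<And>i. i \<in> I \<Longrightarrow> f i \<in> L2_space M"
  shows "L2_norm M (\<lambda>x. \<Sum>i\<in>I. f i x) \<le> (\<Sum>i\<in>I. L2_norm M (f i))"
  using assms
proof (induction I rule: infinite_finite_induct)
  case (insert i I)
  have "L2_norm M (\<lambda>x. f i x + (\<Sum>i\<in>I. f i x)) \<le> L2_norm M (f i) + L2_norm M (\<lambda>x. \<Sum>i\<in>I. f i x)"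
    using insert by (intro L2_norm_triangle L2_space_sum) auto
  also have "L2_norm M (\<lambda>x. \<Sum>i\<in>I. f i x) \<le> (\<Sum>i\<in>I. L2_norm M (f i))"
    using insert by auto
  finally show ?case using insert.hyps by simp
qed (simp_all add: L2_norm_def)

section \<open>Finite orthonormal families\<close>

locale finite_orthonormal =
  fixes I :: "'i set" and e :: "'i \<Rightarrow> 'b::real_inner"
  assumes fin: "finite I"
    and orth: "i \<in> I \<Longrightarrow> j \<in> I \<Longrightarrow> inner (e i) (e j) = (if i = j then 1 else 0)"
begin

definition proj :: "'b \<Rightarrow> 'b" where
  "proj u = (\<Sum>i\<in>I. inner (e i) u *\<^sub>R e i)"

abbreviation V :: "'b set" where "V \<equiv> span (e ` I)"

lemma proj_in_span: "proj u \<in> V"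
  unfolding proj_def by (intro span_sum span_scale span_base) auto

lemma linear_proj: "linear proj"
  by (rule linearI) (simp_all add: proj_def inner_add_right scaleR_left_distrib sum.distrib scaleR_sum_right)

lemma inner_basis_proj: "i \<in> I \<Longrightarrow> inner (e i) (proj u) = inner (e i) u"
proof -
  assume i: "i \<in> I"
  have "inner (e i) (proj u) = (\<Sum>j\<in>I. if i = j then inner (e j) u else 0)"
    unfolding proj_def inner_sum_right by (rule sum.cong) (auto simp: orth i)
  then show ?thesis using i fin by simp
qed

lemma inner_span_proj: "v \<in> V \<Longrightarrow> inner v (proj u) = inner v u"
  by (induction rule: span_induct_alt) (auto simp: inner_add_left inner_basis_proj)

lemma proj_eq: assumes "v \<in> V" shows "proj v = v"
proof -
  have "inner (v - proj v) (v - proj v) = 0"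
    using inner_span_proj[OF span_diff[OF assms proj_in_span[of v]], of v]
    by (simp add: inner_diff_right)
  then show ?thesis by simp
qed

lemma inner_proj_left: "inner (proj u) v = inner u (proj v)"
  using inner_span_proj[OF proj_in_span[of u], of v] inner_span_proj[OF proj_in_span[of v], of u]
  by (simp add: inner_commute)

lemma norm_diff_proj_le: assumes "v \<in> V" shows "norm (u - proj u) \<le> norm (u - v)"
proof (rule power2_le_imp_le)
  have 0: "inner (proj u - v) (u - proj u) = 0"
    using inner_span_proj[OF span_diff[OF proj_in_span assms], of u u] by (simp add: inner_diff_right)
  have "(norm (u - v))\<^sup>2 = (norm ((u - proj u) + (proj u - v)))\<^sup>2" by simp
  also have "\<dots> = (norm (u - proj u))\<^sup>2 + (norm (proj u - v))\<^sup>2"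
    by (rule norm_add_Pythagorean) (use 0 in \<open>simp add: orthogonal_def inner_commute\<close>)
  finally show "(norm (u - proj u))\<^sup>2 \<le> (norm (u - v))\<^sup>2" by simp
qed simp

lemma proj_eq_0_iff: "proj u = 0 \<longleftrightarrow> u \<in> V\<^sup>\<bottom>"
proof
  assume "proj u = 0"
  then show "u \<in> V\<^sup>\<bottom>"
    using inner_span_proj[of _ u] by (auto simp: orthogonal_comp_def orthogonal_def)
next
  assume "u \<in> V\<^sup>\<bottom>"
  then show "proj u = 0"
    by (auto simp: orthogonal_comp_def orthogonal_def proj_def span_base)
qed

lemma double_orthogonal_comp: "V\<^sup>\<bottom>\<^sup>\<bottom> = V"
proof
  show "V \<subseteq> V\<^sup>\<bottom>\<^sup>\<bottom>" by (rule orthogonal_comp_subset)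
  show "V\<^sup>\<bottom>\<^sup>\<bottom> \<subseteq> V"
  proof
    fix u assume u: "u \<in> V\<^sup>\<bottom>\<^sup>\<bottom>"
    have "u - proj u \<in> V\<^sup>\<bottom>"
      using inner_span_proj by (auto simp: orthogonal_comp_def orthogonal_def inner_diff_right)
    then have "inner (u - proj u) u = 0" using u by (auto simp: orthogonal_comp_def orthogonal_def)
    moreover have "inner (u - proj u) (proj u) = 0"
      using inner_span_proj[OF proj_in_span, of u u] by (simp add: inner_diff_left inner_commute[of u])
    ultimately have "inner (u - proj u) (u - proj u) = 0" by (simp add: inner_diff_right)
    then show "u \<in> V" using proj_in_span[of u] by simp
  qed
qed

lemma orth_proj_Times: "orth_proj (UNIV \<times> V) (g, u) = (g :: 'g::real_inner, proj u)"
  unfolding orth_proj_def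
proof (rule the_equality)
  show "(g, proj u) \<in> UNIV \<times> V \<and> (g, u) - (g, proj u) \<in> (UNIV \<times> V)\<^sup>\<bottom>"
    using proj_in_span inner_span_proj
    by (auto simp: orthogonal_comp_def orthogonal_def inner_diff_right)
next
  fix p :: "'g \<times> 'b" assume p: "p \<in> UNIV \<times> V \<and> (g, u) - p \<in> (UNIV \<times> V)\<^sup>\<bottom>"
  obtain g' u' where [simp]: "p = (g', u')" by (cases p)
  have u': "u' \<in> V" and ort: "inner a (g - g') + inner b (u - u') = 0" if "b \<in> V" for a b
    using p that by (auto simp: orthogonal_comp_def orthogonal_def)
  have "g = g'" using ort[of 0 "g - g'"] by (simp add: span_zero)
  have "u - u' \<in> V\<^sup>\<bottom>" using ort[of _ 0] by (auto simp: orthogonal_comp_def orthogonal_def)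
  then have "proj (u - u') = 0" by (simp add: proj_eq_0_iff)
  then have "proj u = u'" using linear_diff[OF linear_proj] proj_eq[OF u'[OF span_zero]] by simp
  then show "p = (g, proj u)" using \<open>g = g'\<close> by simp
qed

lemma independent_basis: "independent (e ` I)"
proof -
  have "pairwise orthogonal (e ` I)"
    by (auto simp: pairwise_def orthogonal_def orth)
  moreover have "0 \<notin> e ` I"
    using orth by (metis imageE inner_zero_left zero_neq_one)
  ultimately show "independent (e ` I)" by (rule pairwise_orthogonal_independent)
qed

text \<open>The image of a basis of \<open>V\<close> is independent and has the same size; a vector of \<open>V\<close> outside its span
would give an independent set in \<open>V\<close> that is larger than the basis. The argument takes place in \<open>V\<close>,
so the surrounding space may have infinite dimension.\<close>

lemma surj_on_span_if_inj:
  assumes f: "linear f" and VV: "f ` V \<subseteq> V" and inj: "\<And>v. v \<in> V \<Longrightarrow> f v = 0 \<Longrightarrow> v = 0"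
  shows "f ` V = V"
proof
  have injV: "inj_on f V"
  proof (rule inj_onI)
    fix x y assume "x \<in> V" "y \<in> V" "f x = f y"
    then show "x = y" using inj[OF span_diff[of x _ y]] linear_diff[OF f, of x y] by simp
  qed
  have ind: "independent (f ` e ` I)"
    by (rule linear_independent_injective_image[OF f independent_basis injV])
  have card: "card (f ` e ` I) = card (e ` I)"
    by (rule card_image) (rule inj_on_subset[OF injV], rule span_superset)
  have sub: "f ` e ` I \<subseteq> V" using image_mono[OF span_superset] VV by (rule order_trans)
  have "V \<subseteq> span (f ` e ` I)"
  proof
    fix y assume y: "y \<in> V"
    show "y \<in> span (f ` e ` I)"
    proof (rule ccontr)
      assume n: "y \<notin> span (f ` e ` I)"
      then have ind_y: "independent (insert y (f ` e ` I))"
        using ind by (rule independent_insertI)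
      have fin_e: "finite (e ` I)" using fin by (rule finite_imageI)
      have "card (insert y (f ` e ` I)) \<le> card (e ` I)"
        using independent_span_bound[OF fin_e ind_y insert_subsetI[OF y sub]] ..
      moreover have "y \<notin> f ` e ` I" using n span_base[of y "f ` e ` I"] by (rule contrapos_nn)
      ultimately show False using card finite_imageI[OF fin_e, of f] by simp
    qed
  qed
  then show "V \<subseteq> f ` V" using linear_span_image[OF f] by simp
qed (rule VV)

end

text \<open>Gram-Schmidt: each further vector contributes its normalised residual, or nothing if it already
lies in the span.\<close>

lemma finite_orthonormal_span_exists:
  fixes S :: "'b::real_inner set"
  assumes "finite S"
  shows "\<exists>B. finite_orthonormal B (\<lambda>b. b) \<and> span B = span S"
  using assms
proof (induction S)
  case empty
  have "finite_orthonormal ({}::'b set) (\<lambda>b. b)" by unfold_locales auto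
  then show ?case by blast
next
  case (insert x S)
  then obtain B :: "'b set" where B: "finite_orthonormal B (\<lambda>b. b)" "span B = span S" by blast
  interpret finite_orthonormal B "\<lambda>b. b" by (rule B)
  have insert_eq: "span (insert y B) = span (insert x S)"
    if c: "c \<noteq> 0" "v \<in> span B" "x = c *\<^sub>R y + v" for c y v
  proof -
    have le1: "span B \<subseteq> span (insert x S)" unfolding B(2) by (intro span_mono subset_insertI)
    have le2: "span B \<subseteq> span (insert y B)" by (intro span_mono subset_insertI)
    have le3: "S \<subseteq> span B" unfolding B(2) by (rule span_superset)
    have xy: "x \<in> span (insert x S)" "y \<in> span (insert y B)" by (simp_all add: span_base)
    have "v \<in> span (insert x S)" "v \<in> span (insert y B)" using subsetD[OF le1 c(2)] subsetD[OF le2 c(2)] .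
    then have "inverse c *\<^sub>R (x - v) \<in> span (insert x S)" "c *\<^sub>R y + v \<in> span (insert y B)"
      using xy by (simp_all only: span_scale span_diff span_add)
    moreover have "inverse c *\<^sub>R (x - v) = y" using c(1) by (simp add: c(3))
    ultimately have "y \<in> span (insert x S)" "x \<in> span (insert y B)"
      by (simp_all only: c(3)[symmetric])
    moreover have "B \<subseteq> span (insert x S)" "S \<subseteq> span (insert y B)"
      by (rule order_trans[OF span_superset le1], rule order_trans[OF le3 le2])
    ultimately show ?thesis by (intro equalityI span_minimal subspace_span) simp_all
  qed
  show ?case
  proof (cases "x = proj x")
    case True
    then have "x \<in> span S" using proj_in_span[of x] B(2) by simp
    then have "span (insert x S) = span S" by (rule span_redundant)
    then show ?thesis using B by blast
  next
    case False
    define y where "y = sgn (x - proj x)"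
    have ny: "inner y y = 1" using False by (simp add: y_def dot_square_norm norm_sgn)
    have yB: "inner b y = 0" if "b \<in> B" for b
      using inner_span_proj[of b x] that by (simp add: y_def sgn_div_norm inner_diff_right span_base)
    have "finite_orthonormal (insert y B) (\<lambda>b. b)"
    proof
      show "finite (insert y B)" using fin by simp
      fix i j assume "i \<in> insert y B" "j \<in> insert y B"
      then show "inner i j = (if i = j then 1 else 0)"
        using ny yB orth by (auto simp: inner_commute)
    qed
    moreover have "span (insert y B) = span (insert x S)"
    proof (rule insert_eq)
      show "norm (x - proj x) \<noteq> 0" using False by simp
      show "proj x \<in> span B" using proj_in_span by simp
      show "x = norm (x - proj x) *\<^sub>R y + proj x" using False by (simp add: y_def sgn_div_norm)
    qed
    ultimately show ?thesis by blast
  qed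
qed

section \<open>Compressions of definite operators and their pseudo-inverses\<close>

text \<open>
For a definite \<open>C\<close> the compression \<open>A\<close> of \<open>C\<close> to \<open>V\<close> has kernel exactly the orthogonal complement of
\<open>V\<close>, since \<open>A u = 0\<close> forces \<open>inner (proj u) (C (proj u)) = 0\<close>. So \<open>A\<close> restricts to a bijection of
\<open>V\<close>, and on \<open>V\<close> the Moore-Penrose inverse of \<open>A\<close> is the inverse of that bijection.\<close>

context finite_orthonormal
begin

context
  fixes C A :: "'b \<Rightarrow> 'b"
  assumes C: "linear C"
    and definite: "\<And>u. inner u (C u) = 0 \<Longrightarrow> u = 0"
    and A_eq: "A = (\<lambda>u. proj (C (proj u)))"
begin

lemma compression_eq_0_iff: "A u = 0 \<longleftrightarrow> u \<in> V\<^sup>\<bottom>"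
proof
  assume "A u = 0"
  then have "inner (proj u) (C (proj u)) = 0"
    using inner_span_proj[OF proj_in_span, of u "C (proj u)"] by (simp add: A_eq)
  then have "proj u = 0" by (rule definite)
  then show "u \<in> V\<^sup>\<bottom>" by (simp add: proj_eq_0_iff)
next
  assume "u \<in> V\<^sup>\<bottom>"
  then have "proj u = 0" by (simp add: proj_eq_0_iff)
  then show "A u = 0" using linear_0[OF C] linear_0[OF linear_proj] by (simp add: A_eq)
qed

lemma compression_span: "A ` V = V"
proof (rule surj_on_span_if_inj)
  show "linear A" unfolding A_eq
    using linear_compose[OF linear_compose[OF linear_proj C] linear_proj] by (simp add: o_def)
  show "A ` V \<subseteq> V" using proj_in_span by (auto simp: A_eq)
  fix v assume v: "v \<in> V" "A v = 0"
  then have "proj v = 0" by (simp add: compression_eq_0_iff proj_eq_0_iff)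
  then show "v = 0" using proj_eq[OF v(1)] by simp
qed

lemma range_compression: "range A = V"
proof
  show "range A \<subseteq> V" using proj_in_span by (auto simp: A_eq)
  show "V \<subseteq> range A" using compression_span by blast
qed

lemma span_le_pinv_dom: "V \<subseteq> pinv_dom A"
proof
  fix y assume "y \<in> V"
  then show "y \<in> pinv_dom A" unfolding pinv_dom_def range_compression
    by (intro CollectI exI[of _ y] exI[of _ 0]) (simp add: subspace_0[OF subspace_orthogonal_comp])
qed

lemma pinv_compression:
  assumes y: "y \<in> V"
  shows "pinv A y \<in> V" "A (pinv A y) = y"
proof -
  have the: "(THE r. r \<in> range A \<and> y - r \<in> (range A)\<^sup>\<bottom>) = y"
    unfolding range_compression
  proof (rule the_equality)
    show "y \<in> V \<and> y - y \<in> V\<^sup>\<bottom>" using y by (simp add: subspace_0[OF subspace_orthogonal_comp])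
    fix r assume r: "r \<in> V \<and> y - r \<in> V\<^sup>\<bottom>"
    then have "proj (y - r) = 0" by (simp add: proj_eq_0_iff)
    then show "r = y" using proj_eq[OF span_diff[OF y, of r]] r by simp
  qed
  have ker: "{x. A x = 0}\<^sup>\<bottom> = V"
    using double_orthogonal_comp by (simp add: compression_eq_0_iff)
  have "y \<in> A ` V" using y by (simp add: compression_span)
  then show "pinv A y \<in> V" "A (pinv A y) = y"
    unfolding pinv_def the ker by (auto intro: inv_into_into f_inv_into_f)
qed

end

end

section \<open>Operator-valued Bochner integrals and covariance operators\<close>

lemma norm_tensor_op_le: "norm (tensor_op g h) \<le> norm g * norm h"
proof (rule norm_blinfun_bound)
  fix u
  have "\<bar>inner h u\<bar> * norm g \<le> (norm h * norm u) * norm g"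
    by (intro mult_right_mono Cauchy_Schwarz_ineq2) simp
  then show "norm (blinfun_apply (tensor_op g h) u) \<le> norm g * norm h * norm u"
    by (simp add: tensor_op_apply mult_ac)
qed simp

lemma bounded_bilinear_tensor_op:
  "bounded_bilinear (tensor_op :: 'g::real_normed_vector \<Rightarrow> 'h::real_inner \<Rightarrow> _)"
proof
  show "\<exists>c. \<forall>(g::'g) (h::'h). norm (tensor_op g h) \<le> norm g * norm h * c"
    by (intro exI[of _ 1] allI) (simp add: norm_tensor_op_le)
qed (auto intro!: blinfun_eqI simp: tensor_op_apply blinfun.bilinear_simps inner_add_left algebra_simps)

lemma ennreal_tendsto_0_if_le:
  fixes f g :: "nat \<Rightarrow> ennreal"
  assumes "\<And>i. f i \<le> g i" "g \<longlonglongrightarrow> 0"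
  shows "f \<longlonglongrightarrow> 0"
  by (rule tendsto_sandwich[of "\<lambda>_. 0" f _ g]) (use assms in auto)

text \<open>A bounded linear map into a separable space turns an operator-valued integral into an ordinary
Bochner integral. Applied to evaluation at a vector, this reduces statements on covariance
operators, uniqueness of the integral included, to integrals of vectors.\<close>

lemma has_bochner_integral_if_op_bochner:
  fixes T :: "'b::real_normed_vector \<Rightarrow> 'c::{real_normed_vector, second_countable_topology}"
  assumes T: "bounded_linear T" and f: "has_op_bochner_integral M f I"
  shows "has_bochner_integral M (\<lambda>x. T (f x)) (T I)"
proof -
  interpret T: bounded_linear T by fact
  obtain s where fm: "f \<in> borel_measurable M"
    and s: "\<And>i. Bochner_Integration.simple_bochner_integrable M (s i)"
    and lim0: "(\<lambda>i. \<integral>\<^sup>+x. ennreal (norm (f x - s i x)) \<partial>M) \<longlonglongrightarrow> 0"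
    and lim: "(\<lambda>i. Bochner_Integration.simple_bochner_integral M (s i)) \<longlonglongrightarrow> I"
    using f unfolding has_op_bochner_integral_def by blast
  have "T \<in> borel_measurable borel"
    by (intro borel_measurable_continuous_onI T.continuous_on continuous_on_id)
  then have Tf [measurable]: "(\<lambda>x. T (f x)) \<in> borel_measurable M" using fm by measurable
  have Ts: "Bochner_Integration.simple_bochner_integrable M (\<lambda>x. T (s i x))" for i
    by (rule simple_bochner_integrable_compose2[where p = "\<lambda>x y. T x", OF T.zero s s])
  then have [measurable]: "(\<lambda>x. T (s i x)) \<in> borel_measurable M" for i
    by (auto intro: borel_measurable_simple_function elim: Bochner_Integration.simple_bochner_integrable.cases)
  obtain c where c: "c > 0" "\<And>x. norm (T x) \<le> norm x * c" using T.pos_bounded by blast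
  show ?thesis
  proof (rule has_bochner_integral.intros[OF Tf Ts])
    show "(\<lambda>i. \<integral>\<^sup>+x. ennreal (norm (T (f x) - T (s i x))) \<partial>M) \<longlonglongrightarrow> 0"
    proof (rule ennreal_tendsto_0_if_le[rotated])
      show "(\<lambda>i. ennreal c * (\<integral>\<^sup>+x. ennreal (norm (f x - s i x)) \<partial>M)) \<longlonglongrightarrow> 0"
        using ennreal_tendsto_cmult[OF _ lim0, of "ennreal c"] by simp
      fix i
      show "(\<integral>\<^sup>+x. ennreal (norm (T (f x) - T (s i x))) \<partial>M)
          \<le> ennreal c * (\<integral>\<^sup>+x. ennreal (norm (f x - s i x)) \<partial>M)"
      proof -
        \<comment> \<open>The constant is pulled out of the left-hand integral: only there is the integrand known to be measurable.\<close>
        have "(\<integral>\<^sup>+x. ennreal (norm (T (f x) - T (s i x))) \<partial>M)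
            = (\<integral>\<^sup>+x. ennreal c * ennreal (norm (T (f x) - T (s i x)) / c) \<partial>M)"
          using c(1) by (intro nn_integral_cong) (simp flip: ennreal_mult')
        also have "\<dots> = ennreal c * (\<integral>\<^sup>+x. ennreal (norm (T (f x) - T (s i x)) / c) \<partial>M)"
          by (rule nn_integral_cmult) measurable
        also have "\<dots> \<le> ennreal c * (\<integral>\<^sup>+x. ennreal (norm (f x - s i x)) \<partial>M)"
          using c by (intro mult_left_mono nn_integral_mono ennreal_leI)
            (simp_all add: T.diff[symmetric] field_simps)
        finally show "(\<integral>\<^sup>+x. ennreal (norm (T (f x) - T (s i x))) \<partial>M)
          \<le> ennreal c * (\<integral>\<^sup>+x. ennreal (norm (f x - s i x)) \<partial>M)" .
      qed
    qed
    show "(\<lambda>i. Bochner_Integration.simple_bochner_integral M (\<lambda>x. T (s i x))) \<longlonglongrightarrow> T I"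
      using T.tendsto[OF lim] s by (simp add: simple_bochner_integral_linear T.linear_axioms)
  qed
qed

text \<open>The operators need not form a separable space, but the pair \<open>(U, V)\<close> takes its values in one. Simple
functions \<open>(a i, b i)\<close> approximating the pair give simple operators \<open>tensor_op (a i) (b i)\<close>; bilinearity
bounds their error by the real function \<open>e i\<close>, which converges to zero and is dominated by a
multiple of the integrable function \<open>norm (p x)\<^sup>2\<close>. So the errors converge in mean and the simple
integrals form a Cauchy sequence in the operator norm.\<close>

lemma has_op_bochner_integral_tensor_op_exists:
  fixes U :: "'a \<Rightarrow> 'g::{real_inner, banach, second_countable_topology}"
    and V :: "'a \<Rightarrow> 'h::{real_inner, second_countable_topology}"
  assumes M: "finite_measure M" and U: "U \<in> L2_space M" and V: "V \<in> L2_space M"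
  shows "\<exists>I. has_op_bochner_integral M (\<lambda>x. tensor_op (U x) (V x)) I"
proof -
  interpret finite_measure M by fact
  interpret B: bounded_bilinear "tensor_op :: 'g \<Rightarrow> 'h \<Rightarrow> _" by (rule bounded_bilinear_tensor_op)
  note [measurable] = L2_spaceD(1)[OF U] L2_spaceD(1)[OF V]
  define p where "p = (\<lambda>x. (U x, V x))"
  have p [measurable]: "p \<in> borel_measurable M" unfolding p_def by measurable
  have np: "(norm (p x))\<^sup>2 = (norm (U x))\<^sup>2 + (norm (V x))\<^sup>2" for x
    by (simp add: p_def norm_Pair)
  from borel_measurable_implies_sequence_metric[OF p, of 0]
  obtain s where s: "\<And>i. simple_function M (s i)"
    and s_lim: "\<And>x. x \<in> space M \<Longrightarrow> (\<lambda>i. s i x) \<longlonglongrightarrow> p x"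
    and s_le: "\<And>i x. x \<in> space M \<Longrightarrow> norm (s i x) \<le> 2 * norm (p x)"
    by (simp add: dist_norm) metis
  define a where "a = (\<lambda>i x. fst (s i x))"
  define b where "b = (\<lambda>i x. snd (s i x))"
  define t where "t = (\<lambda>i x. tensor_op (a i x) (b i x))"
  define e where "e = (\<lambda>i x. norm (a i x) * norm (V x - b i x) + norm (U x - a i x) * norm (V x))"
  have [measurable]: "s i \<in> borel_measurable M" for i using s by (rule borel_measurable_simple_function)
  have [measurable]: "a i \<in> borel_measurable M" "b i \<in> borel_measurable M" for i
    unfolding a_def b_def by (rule borel_measurable_simple_function[OF simple_function_compose1[OF s]])+
  have [measurable]: "e i \<in> borel_measurable M" for i unfolding e_def by measurable
  have e0: "0 \<le> e i x" for i x by (simp add: e_def)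
  have e_le: "e i x \<le> 9 * (norm (p x))\<^sup>2" if "x \<in> space M" for i x
  proof -
    have *: "norm (p x - s i x) \<le> 3 * norm (p x)"
      using norm_triangle_ineq4[of "p x" "s i x"] s_le[OF that, of i] by simp
    have "p x - s i x = (U x - a i x, V x - b i x)" by (simp add: p_def a_def b_def prod_eq_iff)
    then have 1: "norm (V x - b i x) \<le> 3 * norm (p x)" "norm (U x - a i x) \<le> 3 * norm (p x)"
      using order_trans[OF norm_snd_le *[unfolded \<open>p x - s i x = _\<close>]]
        order_trans[OF norm_fst_le *[unfolded \<open>p x - s i x = _\<close>]] by simp_all
    have "norm (a i x) \<le> norm (s i x)"
      using norm_fst_le[of "a i x" "b i x"] by (simp add: a_def b_def)
    then have 2: "norm (a i x) \<le> 2 * norm (p x)" using s_le[OF that, of i] by linarith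
    have 3: "norm (V x) \<le> norm (p x)" by (simp add: p_def norm_snd_le)
    have "norm (a i x) * norm (V x - b i x) \<le> (2 * norm (p x)) * (3 * norm (p x))"
      by (rule mult_mono[OF 2 1(1)]) simp_all
    moreover have "norm (U x - a i x) * norm (V x) \<le> (3 * norm (p x)) * norm (p x)"
      by (rule mult_mono[OF 1(2) 3]) simp_all
    ultimately show ?thesis by (simp add: e_def power2_eq_square)
  qed
  have p2: "integrable M (\<lambda>x. 9 * (norm (p x))\<^sup>2)"
    using L2_spaceD(2)[OF U] L2_spaceD(2)[OF V] by (simp add: np)
  have e_lim: "(\<lambda>i. e i x) \<longlonglongrightarrow> 0" if "x \<in> space M" for x
  proof -
    have "(\<lambda>i. a i x) \<longlonglongrightarrow> U x" "(\<lambda>i. b i x) \<longlonglongrightarrow> V x"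
      using tendsto_fst[OF s_lim[OF that]] tendsto_snd[OF s_lim[OF that]]
      by (simp_all add: a_def b_def p_def)
    then have "(\<lambda>i. e i x) \<longlonglongrightarrow> norm (U x) * norm (V x - V x) + norm (U x - U x) * norm (V x)"
      unfolding e_def by (intro tendsto_intros)
    then show ?thesis by simp
  qed
  have e_int: "integrable M (e i)" for i
  proof (rule Bochner_Integration.integrable_bound[OF p2])
    show "AE x in M. norm (e i x) \<le> norm (9 * (norm (p x))\<^sup>2)"
    proof (rule AE_I2)
      fix x assume "x \<in> space M"
      then show "norm (e i x) \<le> norm (9 * (norm (p x))\<^sup>2)" using e0[of i x] e_le[of x i] by simp
    qed
  qed measurable
  have E_lim: "(\<lambda>i. \<integral>x. e i x \<partial>M) \<longlonglongrightarrow> 0"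
  proof -
    have "(\<lambda>i. \<integral>x. e i x \<partial>M) \<longlonglongrightarrow> (\<integral>x. 0 \<partial>M)"
    proof (rule integral_dominated_convergence[OF _ _ p2])
      show "AE x in M. (\<lambda>i. e i x) \<longlonglongrightarrow> 0" by (rule AE_I2) (rule e_lim)
      show "AE x in M. norm (e i x) \<le> 9 * (norm (p x))\<^sup>2" for i
      proof (rule AE_I2)
        fix x assume "x \<in> space M"
        then show "norm (e i x) \<le> 9 * (norm (p x))\<^sup>2" using e0[of i x] e_le[of x i] by simp
      qed
    qed measurable
    then show ?thesis by simp
  qed
  have t_simple: "Bochner_Integration.simple_bochner_integrable M (t i)" for i
    unfolding t_def a_def b_def
    by (intro Bochner_Integration.simple_bochner_integrable.intros simple_function_compose1[OF s]) simp
  have t_err: "norm (tensor_op (U x) (V x) - t i x) \<le> e i x" for i x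
  proof -
    have "tensor_op (U x) (V x) - t i x
        = tensor_op (a i x) (V x - b i x) + tensor_op (U x - a i x) (V x)"
      by (simp add: t_def B.diff_left B.diff_right)
    also have "norm \<dots> \<le> e i x"
      unfolding e_def by (intro norm_triangle_le add_mono norm_tensor_op_le)
    finally show ?thesis .
  qed
  define S where "S = (\<lambda>i. Bochner_Integration.simple_bochner_integral M (t i))"
  have S_diff: "norm (S i - S j) \<le> (\<integral>x. e i x \<partial>M) + (\<integral>x. e j x \<partial>M)" for i j
  proof -
    have ti: "Bochner_Integration.simple_bochner_integrable M (\<lambda>x. t i x - t j x)"
      by (rule simple_bochner_integrable_compose2[where p = "(-)", OF _ t_simple t_simple]) simp
    have "ennreal (norm (S i - S j)) = ennreal (norm (Bochner_Integration.simple_bochner_integral M (\<lambda>x. t i x - t j x)))"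
      by (simp add: S_def simple_bochner_integral_diff t_simple)
    also have "\<dots> \<le> ennreal (Bochner_Integration.simple_bochner_integral M (\<lambda>x. norm (t i x - t j x)))"
      by (intro ennreal_leI simple_bochner_integral_norm_bound ti)
    also have "\<dots> = (\<integral>\<^sup>+x. ennreal (norm (t i x - t j x)) \<partial>M)"
      by (rule simple_bochner_integral_eq_nn_integral[OF
            simple_bochner_integrable_compose2[where p = "\<lambda>x y. norm (x - y)", OF _ t_simple t_simple]]) simp_all
    also have "\<dots> \<le> (\<integral>\<^sup>+x. ennreal (e i x + e j x) \<partial>M)"
    proof (intro nn_integral_mono ennreal_leI)
      fix x
      have "norm (t i x - t j x) \<le> norm (t i x - tensor_op (U x) (V x)) + norm (tensor_op (U x) (V x) - t j x)"
        using norm_triangle_ineq[of "t i x - tensor_op (U x) (V x)" "tensor_op (U x) (V x) - t j x"] by simp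
      then show "norm (t i x - t j x) \<le> e i x + e j x"
        using t_err[of x i] t_err[of x j] by (simp add: norm_minus_commute)
    qed
    also have "\<dots> = ennreal ((\<integral>x. e i x \<partial>M) + (\<integral>x. e j x \<partial>M))"
      using e_int e0 by (subst nn_integral_eq_integral) auto
    finally show ?thesis
      by (rule iffD1[OF ennreal_le_iff, rotated]) (intro add_nonneg_nonneg Bochner_Integration.integral_nonneg e0)
  qed
  have "Cauchy S"
  proof (rule metric_CauchyI)
    fix r :: real assume "r > 0"
    then obtain N where N: "\<And>n. n \<ge> N \<Longrightarrow> \<bar>\<integral>x. e n x \<partial>M\<bar> < r / 2"
      using LIMSEQ_D[OF E_lim, of "r / 2"] by auto
    have "dist (S m) (S n) < r" if "m \<ge> N" "n \<ge> N" for m n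
      using S_diff[of m n] N[OF that(1)] N[OF that(2)] by (simp add: dist_norm)
    then show "\<exists>N. \<forall>m\<ge>N. \<forall>n\<ge>N. dist (S m) (S n) < r" by blast
  qed
  then obtain I where I: "S \<longlonglongrightarrow> I" using Cauchy_convergent_iff convergent_def by blast
  have "has_op_bochner_integral M (\<lambda>x. tensor_op (U x) (V x)) I"
    unfolding has_op_bochner_integral_def
  proof (intro conjI exI[of _ t] allI)
    have "continuous_on UNIV (\<lambda>q. tensor_op (fst q :: 'g) (snd q :: 'h))"
      by (intro B.continuous_on continuous_on_fst continuous_on_snd continuous_on_id)
    then have "(\<lambda>q. tensor_op (fst q :: 'g) (snd q :: 'h)) \<in> borel_measurable borel"
      by (rule borel_measurable_continuous_onI)
    from measurable_compose[OF p this]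
    show "(\<lambda>x. tensor_op (U x) (V x)) \<in> borel_measurable M" by (simp add: p_def)
    show "(\<lambda>i. \<integral>\<^sup>+x. ennreal (norm (tensor_op (U x) (V x) - t i x)) \<partial>M) \<longlonglongrightarrow> 0"
    proof (rule ennreal_tendsto_0_if_le[rotated])
      show "(\<lambda>i. ennreal (\<integral>x. e i x \<partial>M)) \<longlonglongrightarrow> 0" using tendsto_ennrealI[OF E_lim] by simp
      have "(\<integral>\<^sup>+x. ennreal (norm (tensor_op (U x) (V x) - t i x)) \<partial>M) \<le> (\<integral>\<^sup>+x. ennreal (e i x) \<partial>M)" for i
        by (intro nn_integral_mono ennreal_leI t_err)
      then show "(\<integral>\<^sup>+x. ennreal (norm (tensor_op (U x) (V x) - t i x)) \<partial>M) \<le> ennreal (\<integral>x. e i x \<partial>M)" for i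
        using e_int e0 by (simp add: nn_integral_eq_integral)
    qed
  qed (use t_simple I in \<open>simp_all add: S_def\<close>)
  then show ?thesis ..
qed

lemma uncentred_cov_apply:
  fixes U :: "'a \<Rightarrow> 'g::{real_inner, banach, second_countable_topology}"
    and V :: "'a \<Rightarrow> 'h::{real_inner, second_countable_topology}"
  assumes M: "finite_measure M" and U: "U \<in> L2_space M" and V: "V \<in> L2_space M"
  shows "has_bochner_integral M (\<lambda>x. inner (V x) u *\<^sub>R U x) (blinfun_apply (uncentred_cov M U V) u)"
proof -
  have app: "has_bochner_integral M (\<lambda>x. inner (V x) u *\<^sub>R U x) (blinfun_apply I u)"
    if "has_op_bochner_integral M (\<lambda>x. tensor_op (U x) (V x)) I" for I u
    using has_bochner_integral_if_op_bochner[OF blinfun.bounded_linear_left that, of u]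
    by (simp add: tensor_op_apply)
  obtain I where I: "has_op_bochner_integral M (\<lambda>x. tensor_op (U x) (V x)) I"
    using has_op_bochner_integral_tensor_op_exists[OF M U V] by blast
  have "uncentred_cov M U V = I"
    unfolding uncentred_cov_def op_bochner_integral_def
  proof (rule the_equality, rule I)
    fix I' assume "has_op_bochner_integral M (\<lambda>x. tensor_op (U x) (V x)) I'"
    then show "I' = I" by (intro blinfun_eqI has_bochner_integral_eq[OF app app[OF I]])
  qed
  then show ?thesis using app[OF I] by simp
qed

lemma inner_uncentred_cov:
  fixes U :: "'a \<Rightarrow> 'g::{real_inner, banach, second_countable_topology}"
    and V :: "'a \<Rightarrow> 'h::{real_inner, second_countable_topology}"
  assumes "finite_measure M" "U \<in> L2_space M" "V \<in> L2_space M"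
  shows "inner g (blinfun_apply (uncentred_cov M U V) u) = (\<integral>x. inner g (U x) * inner u (V x) \<partial>M)"
  using has_bochner_integral_inner_right[OF uncentred_cov_apply[OF assms], of g u]
  by (simp add: has_bochner_integral_integral_eq[symmetric] inner_commute[of u] mult.commute)

section \<open>Disintegration along a regular conditional distribution\<close>

locale regular_conditional = prob_space M
  for M :: "'w measure" and MX :: "'x measure" and X :: "'w \<Rightarrow> 'x"
    and MY :: "'y measure" and Y :: "'w \<Rightarrow> 'y" and K :: "'x \<Rightarrow> 'y measure" +
  assumes X [measurable]: "X \<in> measurable M MX" and Y [measurable]: "Y \<in> measurable M MY"
    and rcd: "regular_cond_distr M MX X MY Y K"
begin

abbreviation PX :: "'x measure" where "PX \<equiv> distr M MX X"

lemma K_subprob [measurable]: "K \<in> measurable MX (subprob_algebra MY)"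
  using rcd unfolding regular_cond_distr_def by (blast intro: measurable_prob_algebraD)

lemma prob_space_K: "x \<in> space MX \<Longrightarrow> prob_space (K x)"
  and sets_K: "x \<in> space MX \<Longrightarrow> sets (K x) = sets MY"
proof -
  assume x: "x \<in> space MX"
  have "K \<in> measurable MX (prob_algebra MY)" using rcd by (simp add: regular_cond_distr_def)
  from measurable_space[OF this x] show "prob_space (K x)" "sets (K x) = sets MY"
    by (auto simp: space_prob_algebra)
qed

lemma measurable_K: "x \<in> space MX \<Longrightarrow> g \<in> measurable MY N \<Longrightarrow> g \<in> measurable (K x) N"
  using measurable_cong_sets[OF sets_K refl] by blast

lemma measurable_section:
  assumes F: "F \<in> borel_measurable (MX \<Otimes>\<^sub>M MY)" and x: "x \<in> space MX"
  shows "(\<lambda>y. F (x, y)) \<in> borel_measurable (K x)"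
  by (rule measurable_K[OF x]) (rule measurable_compose[OF measurable_Pair1'[OF x] F])

lemma measurable_distr_Pair:
  "(\<lambda>x. distr (K x) (MX \<Otimes>\<^sub>M MY) (Pair x)) \<in> measurable PX (subprob_algebra (MX \<Otimes>\<^sub>M MY))"
proof -
  have "(\<lambda>(x, y). (x, y)) \<in> measurable (MX \<Otimes>\<^sub>M MY) (MX \<Otimes>\<^sub>M MY)" by simp
  from measurable_distr2[OF this K_subprob] show ?thesis by simp
qed

lemma measurable_integral_K:
  fixes F :: "'x \<times> 'y \<Rightarrow> real"
  assumes F: "F \<in> borel_measurable (MX \<Otimes>\<^sub>M MY)"
  shows "(\<lambda>x. \<integral>y. F (x, y) \<partial>K x) \<in> borel_measurable PX"
proof -
  have "(\<lambda>x. \<integral>p. F p \<partial>distr (K x) (MX \<Otimes>\<^sub>M MY) (Pair x)) \<in> borel_measurable PX"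
    by (rule measurable_compose[OF measurable_distr_Pair integral_measurable_subprob_algebra[OF F]])
  also have "?this \<longleftrightarrow> (\<lambda>x. \<integral>y. F (x, y) \<partial>K x) \<in> borel_measurable PX"
    by (intro measurable_cong integral_distr measurable_K measurable_Pair1' F) simp_all
  finally show ?thesis .
qed

text \<open>The defining equation of a regular conditional distribution, which speaks of rectangles, determines
the joint law, because the rectangles are stable under intersection and generate the product
\<open>\<sigma>\<close>-algebra.\<close>

lemma distr_Pair_eq_bind:
  "distr M (MX \<Otimes>\<^sub>M MY) (\<lambda>\<omega>. (X \<omega>, Y \<omega>)) = PX \<bind> (\<lambda>x. distr (K x) (MX \<Otimes>\<^sub>M MY) (Pair x))"
    (is "?L = ?R")
proof -
  define N where "N = (\<lambda>x. distr (K x) (MX \<Otimes>\<^sub>M MY) (Pair x))"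
  have N: "N \<in> measurable PX (subprob_algebra (MX \<Otimes>\<^sub>M MY))"
    unfolding N_def by (rule measurable_distr_Pair)
  have ne: "space PX \<noteq> {}" using measurable_space[OF X] not_empty by auto
  have R_sets: "sets (PX \<bind> N) = sets (MX \<Otimes>\<^sub>M MY)"
    using N ne by (rule sets_bind_measurable)
  let ?G = "{a \<times> b | a b. a \<in> sets MX \<and> b \<in> sets MY}"
  have "?L = PX \<bind> N"
  proof (rule measure_eqI_generator_eq[where E = ?G and \<Omega> = "space MX \<times> space MY"
        and A = "\<lambda>_. space MX \<times> space MY"])
    show "Int_stable ?G" by (rule Int_stable_pair_measure_generator)
    show "?G \<subseteq> Pow (space MX \<times> space MY)" by (auto dest: sets.sets_into_space)
    show "sets ?L = sigma_sets (space MX \<times> space MY) ?G" by (simp add: sets_pair_measure)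
    show "sets (PX \<bind> N) = sigma_sets (space MX \<times> space MY) ?G"
      by (simp add: R_sets sets_pair_measure)
    show "range (\<lambda>_::nat. space MX \<times> space MY) \<subseteq> ?G" by auto
    show "(\<Union>i::nat. space MX \<times> space MY) = space MX \<times> space MY" by simp
    show "emeasure ?L (space MX \<times> space MY) \<noteq> \<infinity>" for i :: nat
      using finite_measure.emeasure_finite[OF finite_measure_distr[of "\<lambda>\<omega>. (X \<omega>, Y \<omega>)" "MX \<Otimes>\<^sub>M MY"]]
      by simp
    fix C assume "C \<in> ?G"
    then obtain A B where C: "C = A \<times> B" and A: "A \<in> sets MX" and B: "B \<in> sets MY" by auto
    have "emeasure ?L C = emeasure M {\<omega>\<in>space M. X \<omega> \<in> A \<and> Y \<omega> \<in> B}"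
      using A B unfolding C by (subst emeasure_distr) (auto intro!: arg_cong[where f = "emeasure M"])
    also have "\<dots> = (\<integral>\<^sup>+x\<in>A. emeasure (K x) B \<partial>PX)"
      using rcd A B by (simp add: regular_cond_distr_def)
    also have "\<dots> = (\<integral>\<^sup>+x. emeasure (N x) C \<partial>PX)"
    proof (rule nn_integral_cong)
      fix x assume "x \<in> space PX"
      then have x: "x \<in> space MX" by simp
      have sp: "space (K x) = space MY" using sets_K[OF x] by (rule sets_eq_imp_space_eq)
      have "emeasure (N x) C = emeasure (K x) (Pair x -` C \<inter> space (K x))"
        unfolding N_def C using A B measurable_K[OF x measurable_Pair1'[OF x]]
        by (intro emeasure_distr) auto
      also have "Pair x -` C \<inter> space (K x) = (if x \<in> A then B else {})"
        using sets.sets_into_space[OF B] by (auto simp: C sp)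
      finally show "emeasure (K x) B * indicator A x = emeasure (N x) C"
        by (simp split: split_indicator)
    qed
    also have "\<dots> = emeasure (PX \<bind> N) C"
      using A B by (subst emeasure_bind[OF ne N]) (auto simp: C)
    finally show "emeasure ?L C = emeasure (PX \<bind> N) C" .
  qed
  then show ?thesis by (simp add: N_def)
qed

lemma nn_integral_disintegration:
  assumes F [measurable]: "F \<in> borel_measurable (MX \<Otimes>\<^sub>M MY)"
  shows "(\<integral>\<^sup>+\<omega>. F (X \<omega>, Y \<omega>) \<partial>M) = (\<integral>\<^sup>+x. \<integral>\<^sup>+y. F (x, y) \<partial>K x \<partial>PX)"
proof -
  have N: "(\<lambda>x. distr (K x) (MX \<Otimes>\<^sub>M MY) (Pair x)) \<in> measurable PX (subprob_algebra (MX \<Otimes>\<^sub>M MY))"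
    by (rule measurable_distr_Pair)
  have "(\<integral>\<^sup>+\<omega>. F (X \<omega>, Y \<omega>) \<partial>M) = (\<integral>\<^sup>+p. F p \<partial>distr M (MX \<Otimes>\<^sub>M MY) (\<lambda>\<omega>. (X \<omega>, Y \<omega>)))"
    by (simp add: nn_integral_distr)
  also have "\<dots> = (\<integral>\<^sup>+x. \<integral>\<^sup>+p. F p \<partial>distr (K x) (MX \<Otimes>\<^sub>M MY) (Pair x) \<partial>PX)"
    unfolding distr_Pair_eq_bind by (rule nn_integral_bind[OF F N])
  also have "\<dots> = (\<integral>\<^sup>+x. \<integral>\<^sup>+y. F (x, y) \<partial>K x \<partial>PX)"
    by (intro nn_integral_cong nn_integral_distr measurable_K measurable_Pair1' F) simp_all
  finally show ?thesis .
qed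

lemma integral_disintegration_nonneg:
  fixes F :: "'x \<times> 'y \<Rightarrow> real"
  assumes F: "F \<in> borel_measurable (MX \<Otimes>\<^sub>M MY)" and nonneg: "\<And>p. 0 \<le> F p"
    and int: "integrable M (\<lambda>\<omega>. F (X \<omega>, Y \<omega>))"
  shows "AE x in PX. integrable (K x) (\<lambda>y. F (x, y))"
    and "has_bochner_integral PX (\<lambda>x. \<integral>y. F (x, y) \<partial>K x) (\<integral>\<omega>. F (X \<omega>, Y \<omega>) \<partial>M)"
proof -
  define \<Phi> where "\<Phi> = (\<lambda>x. \<integral>\<^sup>+y. ennreal (F (x, y)) \<partial>K x)"
  have \<Phi> [measurable]: "\<Phi> \<in> borel_measurable MX"
    unfolding \<Phi>_def
  proof (rule nn_integral_measurable_subprob_algebra2[OF _ K_subprob])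
    have "(\<lambda>p. ennreal (F p)) \<in> borel_measurable (MX \<Otimes>\<^sub>M MY)" using F by simp
    then show "(\<lambda>(x, y). ennreal (F (x, y))) \<in> borel_measurable (MX \<Otimes>\<^sub>M MY)"
      by (simp add: case_prod_unfold)
  qed
  have eq: "(\<integral>\<^sup>+x. \<Phi> x \<partial>PX) = ennreal (\<integral>\<omega>. F (X \<omega>, Y \<omega>) \<partial>M)"
    unfolding \<Phi>_def using nn_integral_disintegration[of "\<lambda>p. ennreal (F p)"] F nn_integral_eq_integral[OF int] nonneg
    by simp
  then have fin: "AE x in PX. \<Phi> x < \<infinity>"
    using nn_integral_PInf_AE[of \<Phi> PX] by (simp add: less_top)
  have sect: "integrable (K x) (\<lambda>y. F (x, y))" if "x \<in> space PX" "\<Phi> x < \<infinity>" for x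
    using that nonneg measurable_section[OF F, of x] by (intro integrableI_nonneg) (auto simp: \<Phi>_def)
  show ae: "AE x in PX. integrable (K x) (\<lambda>y. F (x, y))"
    using fin AE_space by eventually_elim (rule sect)
  have val: "AE x in PX. ennreal (\<integral>y. F (x, y) \<partial>K x) = \<Phi> x"
    using ae by eventually_elim (simp add: \<Phi>_def nn_integral_eq_integral nonneg)
  show "has_bochner_integral PX (\<lambda>x. \<integral>y. F (x, y) \<partial>K x) (\<integral>\<omega>. F (X \<omega>, Y \<omega>) \<partial>M)"
  proof (rule has_bochner_integral_nn_integral[OF measurable_integral_K[OF F]])
    show "AE x in PX. 0 \<le> (\<integral>y. F (x, y) \<partial>K x)" using nonneg by simp
    show "0 \<le> (\<integral>\<omega>. F (X \<omega>, Y \<omega>) \<partial>M)" using nonneg by simp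
    show "(\<integral>\<^sup>+x. ennreal (\<integral>y. F (x, y) \<partial>K x) \<partial>PX) = ennreal (\<integral>\<omega>. F (X \<omega>, Y \<omega>) \<partial>M)"
      unfolding eq[symmetric] by (rule nn_integral_cong_AE[OF val])
  qed
qed

text \<open>Positive and negative part are treated separately. For almost every \<open>x\<close> both sections are integrable,
and only there does the inner integral split.\<close>

lemma integral_disintegration:
  fixes F :: "'x \<times> 'y \<Rightarrow> real"
  assumes F: "F \<in> borel_measurable (MX \<Otimes>\<^sub>M MY)" and int: "integrable M (\<lambda>\<omega>. F (X \<omega>, Y \<omega>))"
  shows "(\<integral>\<omega>. F (X \<omega>, Y \<omega>) \<partial>M) = (\<integral>x. \<integral>y. F (x, y) \<partial>K x \<partial>PX)"
proof -
  define Fp where "Fp = (\<lambda>p. max 0 (F p))"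
  define Fn where "Fn = (\<lambda>p. max 0 (- F p))"
  have F_eq: "F p = Fp p - Fn p" for p by (auto simp: Fp_def Fn_def)
  have m: "Fp \<in> borel_measurable (MX \<Otimes>\<^sub>M MY)" "Fn \<in> borel_measurable (MX \<Otimes>\<^sub>M MY)"
    unfolding Fp_def Fn_def using F by measurable
  have nn: "0 \<le> Fp p" "0 \<le> Fn p" for p by (simp_all add: Fp_def Fn_def)
  have i: "integrable M (\<lambda>\<omega>. Fp (X \<omega>, Y \<omega>))" "integrable M (\<lambda>\<omega>. Fn (X \<omega>, Y \<omega>))"
    unfolding Fp_def Fn_def using int by simp_all
  note p = integral_disintegration_nonneg[OF m(1) nn(1) i(1)]
  note n = integral_disintegration_nonneg[OF m(2) nn(2) i(2)]
  have "(\<integral>x. \<integral>y. F (x, y) \<partial>K x \<partial>PX) = (\<integral>x. (\<integral>y. Fp (x, y) \<partial>K x) - (\<integral>y. Fn (x, y) \<partial>K x) \<partial>PX)"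
  proof (rule integral_cong_AE)
    show "AE x in PX. (\<integral>y. F (x, y) \<partial>K x) = (\<integral>y. Fp (x, y) \<partial>K x) - (\<integral>y. Fn (x, y) \<partial>K x)"
      using p(1) n(1) by eventually_elim (simp add: F_eq)
    show "(\<lambda>x. (\<integral>y. Fp (x, y) \<partial>K x) - (\<integral>y. Fn (x, y) \<partial>K x)) \<in> borel_measurable PX"
      by (intro borel_measurable_diff borel_measurable_has_bochner_integral[OF p(2)]
          borel_measurable_has_bochner_integral[OF n(2)])
  qed (rule measurable_integral_K[OF F])
  also have "\<dots> = (\<integral>\<omega>. Fp (X \<omega>, Y \<omega>) \<partial>M) - (\<integral>\<omega>. Fn (X \<omega>, Y \<omega>) \<partial>M)"
    using has_bochner_integral_diff[OF p(2) n(2)] by (rule has_bochner_integral_integral_eq)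
  also have "\<dots> = (\<integral>\<omega>. F (X \<omega>, Y \<omega>) \<partial>M)"
    using i by (simp add: F_eq)
  finally show ?thesis by simp
qed

text \<open>Jensen's inequality for the squared norm, in the form \<open>norm (mu x)\<^sup>2 \<le> \<integral>y. norm (psi y)\<^sup>2 \<partial>K x\<close>, carries
square integrability from \<open>psi (Y \<omega>)\<close> to the conditional mean.\<close>

lemma cond_mean_embedding_L2:
  fixes psi :: "'y \<Rightarrow> 'g::{real_inner, banach, second_countable_topology}"
  assumes psi: "psi \<in> borel_measurable MY" and L2: "(\<lambda>\<omega>. psi (Y \<omega>)) \<in> L2_space M"
  defines "mu \<equiv> cond_mean_embedding MX K psi"
  shows "mu \<in> L2_space PX"
    and "AE x in PX. x \<in> finite_cond_moment MX K psi"
    and "\<And>x. x \<in> finite_cond_moment MX K psi \<Longrightarrow> integrable (K x) psi"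
proof -
  define q where "q = (\<lambda>x. \<integral>\<^sup>+y. ennreal ((norm (psi y))\<^sup>2) \<partial>K x)"
  note [measurable] = psi
  have q [measurable]: "q \<in> borel_measurable MX" unfolding q_def by measurable
  have qint: "(\<integral>\<^sup>+x. q x \<partial>PX) < \<infinity>"
  proof -
    have "(\<lambda>p. ennreal ((norm (psi (snd p)))\<^sup>2)) \<in> borel_measurable (MX \<Otimes>\<^sub>M MY)" by measurable
    from nn_integral_disintegration[OF this] show ?thesis
      using L2_spaceD(2)[OF L2] by (simp add: q_def integrable_iff_bounded)
  qed
  have fin_eq: "finite_cond_moment MX K psi = {x \<in> space MX. q x < \<infinity>}"
    by (simp add: finite_cond_moment_def q_def)
  have fin [measurable]: "finite_cond_moment MX K psi \<in> sets MX" unfolding fin_eq by measurable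
  show "AE x in PX. x \<in> finite_cond_moment MX K psi"
    using nn_integral_PInf_AE[of q PX] qint AE_space
    by (auto simp: fin_eq less_top elim!: eventually_rev_mp)
  have sq: "integrable (K x) (\<lambda>y. (norm (psi y))\<^sup>2)" and int: "integrable (K x) psi"
    if x: "x \<in> finite_cond_moment MX K psi" for x
  proof -
    have x': "x \<in> space MX" "q x < \<infinity>" using x by (auto simp: fin_eq)
    interpret Kx: prob_space "K x" by (rule prob_space_K[OF x'(1)])
    have m: "psi \<in> borel_measurable (K x)" by (rule measurable_K[OF x'(1) psi])
    show sq: "integrable (K x) (\<lambda>y. (norm (psi y))\<^sup>2)"
      using m x'(2) by (intro integrableI_nonneg) (auto simp: q_def)
    show "integrable (K x) psi"
    proof (rule Bochner_Integration.integrable_bound[OF Bochner_Integration.integrable_add[OF sq Kx.integrable_const[of 1]] m])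
      have "norm (psi y) \<le> (norm (psi y))\<^sup>2 + 1" for y
        using zero_le_power2[of "norm (psi y) - 1"] norm_ge_zero[of "psi y"]
        unfolding power2_diff power_one by linarith
      then show "AE y in K x. norm (psi y) \<le> norm ((norm (psi y))\<^sup>2 + 1)" by simp
    qed
  qed
  show "\<And>x. x \<in> finite_cond_moment MX K psi \<Longrightarrow> integrable (K x) psi" by (rule int)
  have mu [measurable]: "mu \<in> borel_measurable MX"
    unfolding mu_def cond_mean_embedding_def by measurable
  have mu_le: "ennreal ((norm (mu x))\<^sup>2) \<le> q x" if x: "x \<in> space MX" for x
  proof (cases "x \<in> finite_cond_moment MX K psi")
    case True
    interpret Kx: prob_space "K x" by (rule prob_space_K[OF x])
    have mu_x: "mu x = (\<integral>y. psi y \<partial>K x)" using True by (simp add: mu_def cond_mean_embedding_def)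
    have "has_bochner_integral (K x) (\<lambda>y. inner (mu x) (psi y)) (inner (mu x) (mu x))"
      unfolding mu_x by (intro has_bochner_integral_inner_right has_bochner_integral_integrable int True)
    then have i: "integrable (K x) (\<lambda>y. inner (mu x) (psi y))" "(\<integral>y. inner (mu x) (psi y) \<partial>K x) = (norm (mu x))\<^sup>2"
      by (auto simp: has_bochner_integral_iff power2_norm_eq_inner)
    \<comment> \<open>The integrand is the squared distance of \<open>psi y\<close> from the mean.\<close>
    have "0 \<le> (\<integral>y. (norm (psi y))\<^sup>2 - 2 * inner (mu x) (psi y) + (norm (mu x))\<^sup>2 \<partial>K x)"
    proof (rule integral_nonneg_AE, rule AE_I2)
      fix y
      have "(norm (psi y - mu x))\<^sup>2 = (norm (psi y))\<^sup>2 - 2 * inner (mu x) (psi y) + (norm (mu x))\<^sup>2"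
        by (simp add: power2_norm_eq_inner inner_simps inner_commute)
      then show "0 \<le> (norm (psi y))\<^sup>2 - 2 * inner (mu x) (psi y) + (norm (mu x))\<^sup>2"
        by (metis zero_le_power2)
    qed
    also have "\<dots> = (\<integral>y. (norm (psi y))\<^sup>2 \<partial>K x) - (norm (mu x))\<^sup>2"
      using sq[OF True] i by (simp add: Kx.prob_space)
    finally have "(norm (mu x))\<^sup>2 \<le> (\<integral>y. (norm (psi y))\<^sup>2 \<partial>K x)" by simp
    then have "ennreal ((norm (mu x))\<^sup>2) \<le> ennreal (\<integral>y. (norm (psi y))\<^sup>2 \<partial>K x)" by (rule ennreal_leI)
    also have "\<dots> = q x" unfolding q_def by (rule nn_integral_eq_integral[symmetric, OF sq[OF True]]) simp
    finally show ?thesis .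
  qed (simp add: mu_def cond_mean_embedding_def)
  have "(\<integral>\<^sup>+x. ennreal ((norm (mu x))\<^sup>2) \<partial>PX) \<le> (\<integral>\<^sup>+x. q x \<partial>PX)"
    by (intro nn_integral_mono mu_le) simp
  then have "integrable PX (\<lambda>x. (norm (mu x))\<^sup>2)"
    using qint by (intro integrableI_nonneg) (auto intro: le_less_trans)
  then show "mu \<in> L2_space PX" by (simp add: L2_space_def)
qed

end

section \<open>Least-squares approximation in a tensor product\<close>

lemma span_finite_stage:
  fixes h :: "nat \<Rightarrow> 'h::real_vector"
  assumes "v \<in> span (h ` J)"
  shows "\<exists>N. v \<in> span (h ` {i \<in> J. i < N})"
  using assms
proof (induction rule: span_induct_alt)
  case base
  then show ?case by (simp add: span_zero)
next
  case (step c b y)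
  then obtain i N where i: "i \<in> J" "b = h i" and N: "y \<in> span (h ` {i \<in> J. i < N})" by auto
  define N' where "N' = max N (Suc i)"
  have "b \<in> span (h ` {i \<in> J. i < N'})" using i by (intro span_base) (auto simp: N'_def)
  moreover have "y \<in> span (h ` {i \<in> J. i < N'})"
    using N by (rule subsetD[OF span_mono, rotated]) (auto simp: N'_def)
  ultimately show ?case by (blast intro: span_add span_scale)
qed

lemma mult_half_divide:
  fixes k e :: real
  assumes "k > 0"
  shows "k * (e / (2 * k)) = e / 2" "e / (2 * k) * k = e / 2"
  using assms by simp_all

text \<open>Project \<open>mu\<close> onto the span of the finitely many values of a simple function close to \<open>mu\<close>.
At every point the projection is at least as close to \<open>mu\<close> as the simple function.\<close>

lemma finite_rank_approximation:
  fixes mu :: "'a \<Rightarrow> 'g::{real_inner, second_countable_topology}"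
  assumes mu: "mu \<in> L2_space P" and e: "e > 0"
  obtains B where "finite_orthonormal B (\<lambda>b. b)"
    "L2_norm P (\<lambda>x. mu x - finite_orthonormal.proj B (\<lambda>b. b) (mu x)) < e"
proof -
  note [measurable] = L2_spaceD(1)[OF mu]
  from borel_measurable_implies_sequence_metric[OF L2_spaceD(1)[OF mu], of 0]
  obtain s where s: "\<And>i. simple_function P (s i)"
    and s_lim: "\<And>x. x \<in> space P \<Longrightarrow> (\<lambda>i. s i x) \<longlonglongrightarrow> mu x"
    and s_le: "\<And>i x. x \<in> space P \<Longrightarrow> norm (s i x) \<le> 2 * norm (mu x)"
    by (simp add: dist_norm) metis
  have [measurable]: "s i \<in> borel_measurable P" for i using s by (rule borel_measurable_simple_function)
  have le3: "norm (mu x - s i x) \<le> 3 * norm (mu x)" if "x \<in> space P" for x i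
    using norm_triangle_ineq4[of "mu x" "s i x"] s_le[OF that, of i] by simp
  have "(\<lambda>i. \<integral>x. (norm (mu x - s i x))\<^sup>2 \<partial>P) \<longlonglongrightarrow> (\<integral>x. 0 \<partial>P)"
  proof (rule integral_dominated_convergence)
    show "integrable P (\<lambda>x. 9 * (norm (mu x))\<^sup>2)" using L2_spaceD(2)[OF mu] by simp
    show "AE x in P. (\<lambda>i. (norm (mu x - s i x))\<^sup>2) \<longlonglongrightarrow> 0"
    proof (rule AE_I2)
      fix x assume "x \<in> space P"
      then have "(\<lambda>i. (norm (mu x - s i x))\<^sup>2) \<longlonglongrightarrow> (norm (mu x - mu x))\<^sup>2"
        by (intro tendsto_intros s_lim)
      then show "(\<lambda>i. (norm (mu x - s i x))\<^sup>2) \<longlonglongrightarrow> 0" by simp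
    qed
    show "AE x in P. norm ((norm (mu x - s i x))\<^sup>2) \<le> 9 * (norm (mu x))\<^sup>2" for i
    proof (rule AE_I2)
      fix x assume "x \<in> space P"
      from power_mono[OF le3[OF this, of i], of 2]
      show "norm ((norm (mu x - s i x))\<^sup>2) \<le> 9 * (norm (mu x))\<^sup>2" by (simp add: power_mult_distrib)
    qed
  qed measurable
  then have "(\<lambda>i. \<integral>x. (norm (mu x - s i x))\<^sup>2 \<partial>P) \<longlonglongrightarrow> 0" by simp
  then obtain i where i: "\<bar>\<integral>x. (norm (mu x - s i x))\<^sup>2 \<partial>P\<bar> < e\<^sup>2"
    using LIMSEQ_D[of "\<lambda>i. \<integral>x. (norm (mu x - s i x))\<^sup>2 \<partial>P" 0 "e\<^sup>2"] e by auto
  have "finite (s i ` space P)" using s[of i] by (simp add: simple_function_def)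
  then obtain B where B: "finite_orthonormal B (\<lambda>b. b)" "span B = span (s i ` space P)"
    using finite_orthonormal_span_exists by blast
  interpret finite_orthonormal B "\<lambda>b. b" by (rule B)
  have diff: "(\<lambda>x. mu x - s i x) \<in> L2_space P"
  proof (rule L2_space_if_norm_le[OF mu])
    show "\<And>x. x \<in> space P \<Longrightarrow> norm (mu x - s i x) \<le> 3 * norm (mu x)" by (rule le3)
  qed measurable
  have proj_m [measurable]: "(\<lambda>x. proj (mu x)) \<in> borel_measurable P"
    unfolding proj_def by measurable
  have le: "norm (mu x - proj (mu x)) \<le> norm (mu x - s i x)" if "x \<in> space P" for x
    using that by (intro norm_diff_proj_le) (simp add: B(2) span_base)
  have pdiff: "(\<lambda>x. mu x - proj (mu x)) \<in> L2_space P"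
    by (rule L2_space_if_norm_le[OF diff, of _ 1]) (use le in simp_all)
  have "(L2_norm P (\<lambda>x. mu x - proj (mu x)))\<^sup>2 \<le> (\<integral>x. (norm (mu x - s i x))\<^sup>2 \<partial>P)"
    unfolding L2_norm_power2
    by (intro integral_mono L2_spaceD(2)[OF diff] L2_spaceD(2)[OF pdiff] power_mono le) simp_all
  also have "\<dots> < e\<^sup>2" using i by simp
  finally have "L2_norm P (\<lambda>x. mu x - proj (mu x)) < e" by (rule power2_less_imp_less) (use e in simp)
  then show ?thesis using that B(1) by blast
qed

text \<open>The \<open>g\<close> for which \<open>inner g \<circ> mu\<close> lies in the \<open>L\<^sup>2\<close>-closure of the functions \<open>inner u \<circ> phi\<close> form a
closed subspace, as \<open>g \<mapsto> inner g \<circ> mu\<close> is linear and bounded into \<open>L\<^sup>2\<close>. For the feature map of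
\<open>\<G>\<close> this takes the closure condition from the functions \<open>psi y\<close> to all of \<open>\<G>\<close>.\<close>

lemma L2_approximable_all_if_dense:
  fixes mu :: "'a \<Rightarrow> 'g::{real_inner, second_countable_topology}"
    and phi :: "'a \<Rightarrow> 'h::{real_inner, second_countable_topology}"
  assumes mu: "mu \<in> L2_space P" and phi: "phi \<in> L2_space P"
    and dense: "closure (span S) = UNIV"
    and approx: "\<And>g e. g \<in> S \<Longrightarrow> e > 0 \<Longrightarrow> \<exists>u. L2_norm P (\<lambda>x. inner g (mu x) - inner u (phi x)) < e"
    and e: "e > 0"
  shows "\<exists>u. L2_norm P (\<lambda>x. inner g (mu x) - inner u (phi x)) < e"
proof -
  note L = L2_space_diff[OF L2_space_inner(1)[OF mu] L2_space_inner(1)[OF phi]]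
  have span: "\<exists>u. L2_norm P (\<lambda>x. inner v (mu x) - inner u (phi x)) < e"
    if "v \<in> span S" "e > 0" for v and e :: real
    using that
  proof (induction arbitrary: e rule: span_induct_alt)
    case base
    then show ?case by (intro exI[of _ 0]) (simp add: L2_norm_def)
  next
    case (step c b y)
    define d where "d = e / (2 * (\<bar>c\<bar> + 1))"
    have d: "d > 0" using step by (simp add: d_def add_pos_nonneg)
    obtain u1 where u1: "L2_norm P (\<lambda>x. inner b (mu x) - inner u1 (phi x)) < d"
      using approx[OF step.hyps(1) d] by blast
    obtain u2 where u2: "L2_norm P (\<lambda>x. inner y (mu x) - inner u2 (phi x)) < e / 2"
      using step.IH[of "e / 2"] step.prems by auto
    have "L2_norm P (\<lambda>x. inner (c *\<^sub>R b + y) (mu x) - inner (c *\<^sub>R u1 + u2) (phi x))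
        = L2_norm P (\<lambda>x. c *\<^sub>R (inner b (mu x) - inner u1 (phi x)) + (inner y (mu x) - inner u2 (phi x)))"
      by (rule arg_cong[where f = "L2_norm P"]) (simp add: fun_eq_iff inner_add_left algebra_simps)
    also have "\<dots> \<le> L2_norm P (\<lambda>x. c *\<^sub>R (inner b (mu x) - inner u1 (phi x)))
        + L2_norm P (\<lambda>x. inner y (mu x) - inner u2 (phi x))"
      by (intro L2_norm_triangle L2_space_scaleR L)
    also have "\<dots> < e / 2 + e / 2"
    proof (rule add_le_less_mono[OF _ u2])
      have "L2_norm P (\<lambda>x. c *\<^sub>R (inner b (mu x) - inner u1 (phi x))) \<le> \<bar>c\<bar> * d"
        unfolding L2_norm_scaleR using u1 by (intro mult_left_mono) simp_all
      also have "\<dots> \<le> (\<bar>c\<bar> + 1) * d" using d by simp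
      also have "\<dots> = e / 2" unfolding d_def by (rule mult_half_divide(1)) linarith
      finally show "L2_norm P (\<lambda>x. c *\<^sub>R (inner b (mu x) - inner u1 (phi x))) \<le> e / 2" .
    qed
    finally show ?case by auto
  qed
  define d where "d = e / (2 * (L2_norm P mu + 1))"
  have pos: "L2_norm P mu + 1 > 0" using L2_norm_nonneg[of P mu] by linarith
  then have d: "d > 0" using e by (simp add: d_def)
  have "g \<in> closure (span S)" using dense by simp
  then obtain v where v: "v \<in> span S" "dist v g < d" using d by (meson closure_approachable)
  obtain u where u: "L2_norm P (\<lambda>x. inner v (mu x) - inner u (phi x)) < e / 2"
    using span[OF v(1), of "e / 2"] e by auto
  have "L2_norm P (\<lambda>x. inner g (mu x) - inner u (phi x))
      \<le> L2_norm P (\<lambda>x. inner g (mu x) - inner v (mu x)) + L2_norm P (\<lambda>x. inner v (mu x) - inner u (phi x))"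
    by (intro L2_norm_triangle_diff L2_space_inner mu phi)
  also have "\<dots> < e / 2 + e / 2"
  proof (rule add_le_less_mono[OF _ u])
    have "L2_norm P (\<lambda>x. inner g (mu x) - inner v (mu x)) \<le> norm (g - v) * L2_norm P mu"
      using L2_space_inner(2)[OF mu, of "g - v"] by (simp add: inner_diff_left)
    also have "\<dots> \<le> d * (L2_norm P mu + 1)"
      using v(2) d by (intro mult_mono) (simp_all add: dist_norm norm_minus_commute)
    also have "\<dots> = e / 2" unfolding d_def by (rule mult_half_divide(2)[OF pos])
    finally show "L2_norm P (\<lambda>x. inner g (mu x) - inner v (mu x)) \<le> e / 2" .
  qed
  finally show ?thesis by auto
qed

text \<open>Pythagoras: every competitor differs from \<open>a\<close> by a combination of the functions \<open>inner (h i) \<circ> phi\<close>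
with coefficients in the target space, and the residual \<open>mu - a\<close> is orthogonal to all of them. The
hypothesis states this orthogonality componentwise.\<close>

lemma least_squares_minimal:
  fixes mu :: "'a \<Rightarrow> 'g::{real_inner, second_countable_topology}"
    and phi :: "'a \<Rightarrow> 'h::{real_inner, second_countable_topology}"
  assumes mu: "mu \<in> L2_space P" and phi: "phi \<in> L2_space P"
    and a_eq: "\<And>x. a x = (\<Sum>i\<in>I. inner (h i) (phi x) *\<^sub>R c i)"
    and res: "\<And>i g. i \<in> I \<Longrightarrow> (\<integral>x. inner (h i) (phi x) * inner g (mu x - a x) \<partial>P) = 0"
  shows "a \<in> L2_space P"
    and "L2_norm P (\<lambda>x. mu x - a x) \<le> L2_norm P (\<lambda>x. mu x - (\<Sum>i\<in>I. inner (h i) (phi x) *\<^sub>R b i))"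
proof -
  have sum_L2: "(\<lambda>x. \<Sum>i\<in>I. inner (h i) (phi x) *\<^sub>R b i) \<in> L2_space P" for b :: "_ \<Rightarrow> 'g"
  proof (rule L2_space_sum)
    fix i assume "i \<in> I"
    have "(\<lambda>x. inner (h i) (phi x) *\<^sub>R b i) \<in> borel_measurable P"
      using L2_spaceD(1)[OF phi] by measurable
    then show "(\<lambda>x. inner (h i) (phi x) *\<^sub>R b i) \<in> L2_space P"
      by (rule L2_space_if_norm_le[OF L2_space_inner(1)[OF phi, of "h i"], of _ "norm (b i)"])
        (simp add: mult.commute)
  qed
  have a_fun: "a = (\<lambda>x. \<Sum>i\<in>I. inner (h i) (phi x) *\<^sub>R c i)" using a_eq by auto
  show a: "a \<in> L2_space P" unfolding a_fun by (rule sum_L2)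
  define r where "r = (\<lambda>x. mu x - a x)"
  have r: "r \<in> L2_space P" unfolding r_def by (rule L2_space_diff[OF mu a])
  define d where "d = (\<lambda>x. \<Sum>i\<in>I. inner (h i) (phi x) *\<^sub>R (c i - b i))"
  have d: "d \<in> L2_space P" unfolding d_def by (rule sum_L2)
  have "(\<integral>x. inner (r x) (d x) \<partial>P) = (\<integral>x. (\<Sum>i\<in>I. inner (h i) (phi x) * inner (c i - b i) (r x)) \<partial>P)"
    unfolding d_def inner_sum_right by (simp add: inner_commute)
  also have "\<dots> = (\<Sum>i\<in>I. \<integral>x. inner (h i) (phi x) * inner (c i - b i) (r x) \<partial>P)"
    by (intro Bochner_Integration.integral_sum L2_integrable_mult L2_space_inner phi r)
  also have "\<dots> = 0" using res by (simp add: r_def)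
  finally have 0: "(\<integral>x. inner (r x) (d x) \<partial>P) = 0" .
  have "(L2_norm P r)\<^sup>2 \<le> (L2_norm P (\<lambda>x. r x + d x))\<^sup>2"
    using L2_norm_add_power2[OF r d] 0 by simp
  then have "L2_norm P r \<le> L2_norm P (\<lambda>x. r x + d x)" by (rule power2_le_imp_le) simp
  also have "(\<lambda>x. r x + d x) = (\<lambda>x. mu x - (\<Sum>i\<in>I. inner (h i) (phi x) *\<^sub>R b i))"
    by (simp add: fun_eq_iff r_def d_def a_eq scaleR_diff_right sum_subtractf)
  finally show "L2_norm P (\<lambda>x. mu x - a x) \<le> L2_norm P (\<lambda>x. mu x - (\<Sum>i\<in>I. inner (h i) (phi x) *\<^sub>R b i))"
    by (simp add: r_def)
qed

text \<open>\<open>a n\<close> is the \<open>L\<^sup>2\<close>-projection of the vector-valued function \<open>mu\<close> onto the tensor product of the target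
space with the span of the first basis functions \<open>inner (h i) \<circ> phi\<close>; the residual condition
characterises it. The span of the \<open>h i\<close> with \<open>i \<in> J\<close> and \<open>i < n\<close> is called stage \<open>n\<close>.\<close>

locale least_squares_sequence =
  fixes P :: "'a measure"
    and phi :: "'a \<Rightarrow> 'h::{real_inner, second_countable_topology}"
    and mu :: "'a \<Rightarrow> 'g::{real_inner, second_countable_topology}"
    and J :: "nat set" and h :: "nat \<Rightarrow> 'h" and c :: "nat \<Rightarrow> nat \<Rightarrow> 'g" and a :: "nat \<Rightarrow> 'a \<Rightarrow> 'g"
  assumes mu: "mu \<in> L2_space P" and phi: "phi \<in> L2_space P"
    and basis: "complete_orthonormal_on J h"
    and a_eq: "\<And>n x. a n x = (\<Sum>i\<in>{i \<in> J. i < n}. inner (h i) (phi x) *\<^sub>R c n i)"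
    and res: "\<And>n i g. i \<in> J \<Longrightarrow> i < n \<Longrightarrow> (\<integral>x. inner (h i) (phi x) * inner g (mu x - a n x) \<partial>P) = 0"
begin

lemma a_L2: "a n \<in> L2_space P"
  by (rule least_squares_minimal(1)[OF mu phi a_eq res]) auto

lemma a_minimal:
  "L2_norm P (\<lambda>x. mu x - a n x) \<le> L2_norm P (\<lambda>x. mu x - (\<Sum>i\<in>{i \<in> J. i < n}. inner (h i) (phi x) *\<^sub>R b i))"
  by (rule least_squares_minimal(2)[OF mu phi a_eq res]) auto

lemma stage_orthonormal: "finite_orthonormal {i \<in> J. i < n} h"
  using basis by unfold_locales (auto simp: complete_orthonormal_on_def)

lemma stage_expansion:
  assumes v: "v \<in> span (h ` {i \<in> J. i < N})" and n: "N \<le> n"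
  shows "inner v w = (\<Sum>i\<in>{i \<in> J. i < n}. inner (h i) v * inner (h i) w)"
proof -
  interpret finite_orthonormal "{i \<in> J. i < n}" h by (rule stage_orthonormal)
  have "v \<in> span (h ` {i \<in> J. i < n})"
    using v by (rule subsetD[OF span_mono, rotated]) (use n in auto)
  from proj_eq[OF this] have "inner v w = inner (\<Sum>i\<in>{i \<in> J. i < n}. inner (h i) v *\<^sub>R h i) w"
    by (simp add: proj_def)
  then show ?thesis by (simp add: inner_sum_left)
qed

lemma stage_dense:
  assumes "d > 0"
  shows "\<exists>v N. v \<in> span (h ` {i \<in> J. i < N}) \<and> norm (u - v) < d"
proof -
  have "u \<in> closure (span (h ` J))" using basis by (simp add: complete_orthonormal_on_def)
  then obtain v where v: "v \<in> span (h ` J)" "dist v u < d" using assms by (meson closure_approachable)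
  then show ?thesis using span_finite_stage[OF v(1)] by (metis dist_norm norm_minus_commute)
qed

text \<open>Replace \<open>u\<close> by a vector \<open>v\<close> of some stage. From that stage on, \<open>inner v \<circ> phi\<close> is orthogonal to the
residual, and the error made by the replacement is bounded by Cauchy-Schwarz uniformly in \<open>n\<close>, since
by minimality no residual has a larger norm than \<open>mu\<close>.\<close>

lemma weak_convergence:
  "(\<lambda>n. \<integral>x. inner u (phi x) * inner g (a n x) \<partial>P) \<longlonglongrightarrow> (\<integral>x. inner u (phi x) * inner g (mu x) \<partial>P)"
proof (rule LIMSEQ_I)
  fix e :: real assume e: "e > 0"
  \<comment> \<open>The summand \<open>1\<close> keeps the divisor positive.\<close>
  define m where "m = L2_norm P phi * (norm g * L2_norm P mu) + 1"
  have m: "m > 0" unfolding m_def by (intro add_nonneg_pos mult_nonneg_nonneg) simp_all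
  obtain v N where v: "v \<in> span (h ` {i \<in> J. i < N})" "norm (u - v) < e / m"
    using stage_dense[OF divide_pos_pos[OF e m], of u] by blast
  have "norm ((\<integral>x. inner u (phi x) * inner g (a n x) \<partial>P) - (\<integral>x. inner u (phi x) * inner g (mu x) \<partial>P)) < e"
    if n: "n \<ge> N" for n
  proof -
    define r where "r = (\<lambda>x. mu x - a n x)"
    have r: "r \<in> L2_space P" unfolding r_def by (rule L2_space_diff[OF mu a_L2])
    have "L2_norm P r \<le> L2_norm P mu" using a_minimal[of n "\<lambda>_. 0"] by (simp add: r_def)
    note L = L2_space_inner(1)[OF phi] L2_space_inner(1)[OF mu] L2_space_inner(1)[OF a_L2]
      L2_space_inner(1)[OF r]
    have "(\<integral>x. inner v (phi x) * inner g (r x) \<partial>P)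
        = (\<integral>x. (\<Sum>i\<in>{i \<in> J. i < n}. inner (h i) v * (inner (h i) (phi x) * inner g (r x))) \<partial>P)"
      by (simp add: stage_expansion[OF v(1) n] sum_distrib_right mult.assoc)
    also have "\<dots> = (\<Sum>i\<in>{i \<in> J. i < n}. inner (h i) v * (\<integral>x. inner (h i) (phi x) * inner g (r x) \<partial>P))"
      by (subst Bochner_Integration.integral_sum)
        (simp_all add: L2_integrable_mult L)
    also have "\<dots> = 0" using res by (simp add: r_def)
    finally have v0: "(\<integral>x. inner v (phi x) * inner g (r x) \<partial>P) = 0" .
    have "(\<integral>x. inner u (phi x) * inner g (mu x) \<partial>P) - (\<integral>x. inner u (phi x) * inner g (a n x) \<partial>P)
        = (\<integral>x. inner u (phi x) * inner g (r x) \<partial>P)"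
      by (subst Bochner_Integration.integral_diff[symmetric])
        (simp_all add: L2_integrable_mult L r_def inner_diff_right algebra_simps)
    also have "\<dots> = (\<integral>x. inner (u - v) (phi x) * inner g (r x) \<partial>P) + (\<integral>x. inner v (phi x) * inner g (r x) \<partial>P)"
      by (subst Bochner_Integration.integral_add[symmetric])
        (simp_all add: L2_integrable_mult L inner_diff_left algebra_simps)
    also have "\<dots> = (\<integral>x. inner (inner (u - v) (phi x)) (inner g (r x)) \<partial>P)" by (simp add: v0)
    finally have eq: "(\<integral>x. inner u (phi x) * inner g (mu x) \<partial>P) - (\<integral>x. inner u (phi x) * inner g (a n x) \<partial>P)
        = (\<integral>x. inner (inner (u - v) (phi x)) (inner g (r x)) \<partial>P)" .
    have "\<bar>\<integral>x. inner (inner (u - v) (phi x)) (inner g (r x)) \<partial>P\<bar>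
        \<le> L2_norm P (\<lambda>x. inner (u - v) (phi x)) * L2_norm P (\<lambda>x. inner g (r x))"
      by (intro L2_Cauchy_Schwarz L)
    also have "\<dots> \<le> (norm (u - v) * L2_norm P phi) * (norm g * L2_norm P mu)"
    proof (rule mult_mono)
      have "L2_norm P (\<lambda>x. inner g (r x)) \<le> norm g * L2_norm P r" by (rule L2_space_inner(2)[OF r])
      also have "\<dots> \<le> norm g * L2_norm P mu" by (rule mult_left_mono) (use \<open>L2_norm P r \<le> _\<close> in simp_all)
      finally show "L2_norm P (\<lambda>x. inner g (r x)) \<le> norm g * L2_norm P mu" .
    qed (simp_all add: L2_space_inner(2)[OF phi])
    also have "\<dots> \<le> norm (u - v) * m" by (simp add: m_def algebra_simps)
    also have "\<dots> < e" using v(2) m by (simp add: field_simps)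
    finally show ?thesis using eq by (simp add: abs_minus_commute)
  qed
  then show "\<exists>N. \<forall>n\<ge>N. norm ((\<integral>x. inner u (phi x) * inner g (a n x) \<partial>P) - (\<integral>x. inner u (phi x) * inner g (mu x) \<partial>P)) < e"
    by blast
qed

text \<open>By minimality it suffices to find, in some stage, one element of the tensor product close to \<open>mu\<close>.
Project \<open>mu\<close> to a finite-dimensional subspace of the target space and approximate each of the
finitely many coordinate functions separately.\<close>

lemma strong_convergence:
  assumes approx: "\<And>g e. e > 0 \<Longrightarrow> \<exists>u. L2_norm P (\<lambda>x. inner g (mu x) - inner u (phi x)) < e"
  shows "(\<lambda>n. L2_norm P (\<lambda>x. mu x - a n x)) \<longlonglongrightarrow> 0"
proof (rule LIMSEQ_I)
  fix e :: real assume e: "e > 0"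
  obtain B where B: "finite_orthonormal B (\<lambda>b. b)"
    and RB: "L2_norm P (\<lambda>x. mu x - finite_orthonormal.proj B (\<lambda>b. b) (mu x)) < e / 2"
    using finite_rank_approximation[OF mu, of "e / 2"] e by auto
  interpret B: finite_orthonormal B "\<lambda>b. b" by (rule B)
  define d where "d = e / (2 * (real (card B) + 1))"
  have d: "d > 0" using e by (simp add: d_def)
  have "\<exists>v N. v \<in> span (h ` {i \<in> J. i < N}) \<and> L2_norm P (\<lambda>x. inner b (mu x) - inner v (phi x)) \<le> d" for b
  proof -
    obtain u where u: "L2_norm P (\<lambda>x. inner b (mu x) - inner u (phi x)) < d / 2"
      using approx[of "d / 2" b] d by auto
    have pos: "L2_norm P phi + 1 > 0" using L2_norm_nonneg[of P phi] by linarith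
    have "d / (2 * (L2_norm P phi + 1)) > 0" using d pos by simp
    then obtain v N where v: "v \<in> span (h ` {i \<in> J. i < N})" "norm (u - v) < d / (2 * (L2_norm P phi + 1))"
      using stage_dense[of _ u] by blast
    have "L2_norm P (\<lambda>x. inner b (mu x) - inner v (phi x))
      \<le> L2_norm P (\<lambda>x. inner b (mu x) - inner u (phi x)) + L2_norm P (\<lambda>x. inner u (phi x) - inner v (phi x))"
      by (intro L2_norm_triangle_diff L2_space_inner mu phi)
    moreover have "L2_norm P (\<lambda>x. inner u (phi x) - inner v (phi x)) \<le> d / 2"
    proof -
      have "L2_norm P (\<lambda>x. inner u (phi x) - inner v (phi x)) \<le> norm (u - v) * L2_norm P phi"
        using L2_space_inner(2)[OF phi, of "u - v"] by (simp add: inner_diff_left)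
      also have "\<dots> \<le> d / (2 * (L2_norm P phi + 1)) * (L2_norm P phi + 1)"
        using v(2) d pos by (intro mult_mono) simp_all
      also have "\<dots> = d / 2" by (rule mult_half_divide(2)[OF pos])
      finally show ?thesis .
    qed
    ultimately have "L2_norm P (\<lambda>x. inner b (mu x) - inner v (phi x)) \<le> d" using u by linarith
    then show ?thesis using v(1) by blast
  qed
  then obtain v N where v: "\<And>b. v b \<in> span (h ` {i \<in> J. i < N b})"
    and vd: "\<And>b. L2_norm P (\<lambda>x. inner b (mu x) - inner (v b) (phi x)) \<le> d"
    by metis
  \<comment> \<open>A sum is an upper bound for its nonnegative terms, also when \<open>B\<close> is empty.\<close>
  define N0 where "N0 = (\<Sum>b\<in>B. N b)"
  have N0: "N b \<le> N0" if "b \<in> B" for b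
    unfolding N0_def using that B.fin by (intro member_le_sum) auto
  define w where "w = (\<lambda>x. \<Sum>b\<in>B. inner (v b) (phi x) *\<^sub>R b)"
  have dL: "(\<lambda>x. (inner b (mu x) - inner (v b) (phi x)) *\<^sub>R b) \<in> L2_space P" for b
  proof (rule L2_space_if_norm_le)
    show "(\<lambda>x. inner b (mu x) - inner (v b) (phi x)) \<in> L2_space P"
      by (intro L2_space_diff L2_space_inner mu phi)
    show "norm ((inner b (mu x) - inner (v b) (phi x)) *\<^sub>R b) \<le> norm b * norm (inner b (mu x) - inner (v b) (phi x))" for x
      by (simp add: mult.commute)
    show "(\<lambda>x. (inner b (mu x) - inner (v b) (phi x)) *\<^sub>R b) \<in> borel_measurable P"
      using L2_spaceD(1)[OF mu] L2_spaceD(1)[OF phi] by measurable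
  qed
  have Rw: "(\<lambda>x. B.proj (mu x) - w x) = (\<lambda>x. \<Sum>b\<in>B. (inner b (mu x) - inner (v b) (phi x)) *\<^sub>R b)"
    by (simp add: fun_eq_iff w_def B.proj_def scaleR_diff_left sum_subtractf)
  have RwL: "(\<lambda>x. B.proj (mu x) - w x) \<in> L2_space P" unfolding Rw by (intro L2_space_sum dL)
  have R: "(\<lambda>x. mu x - B.proj (mu x)) \<in> L2_space P"
  proof (rule L2_space_if_norm_le[OF mu])
    show "(\<lambda>x. mu x - B.proj (mu x)) \<in> borel_measurable P"
      unfolding B.proj_def using L2_spaceD(1)[OF mu] by measurable
    show "norm (mu x - B.proj (mu x)) \<le> 1 * norm (mu x)" for x
      using B.norm_diff_proj_le[OF span_zero, of "mu x"] by simp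
  qed
  have "L2_norm P (\<lambda>x. B.proj (mu x) - w x) \<le> (\<Sum>b\<in>B. L2_norm P (\<lambda>x. (inner b (mu x) - inner (v b) (phi x)) *\<^sub>R b))"
    unfolding Rw by (intro L2_norm_sum_le dL)
  also have "\<dots> \<le> (\<Sum>b\<in>B. d)"
  proof (rule sum_mono)
    fix b assume "b \<in> B"
    then have "norm b = 1" using B.orth[of b b] by (simp add: norm_eq_1)
    then show "L2_norm P (\<lambda>x. (inner b (mu x) - inner (v b) (phi x)) *\<^sub>R b) \<le> d"
      using vd[of b] by (simp add: L2_norm_def)
  qed
  also have "\<dots> \<le> (real (card B) + 1) * d" using d by simp
  also have "\<dots> = e / 2" unfolding d_def by (rule mult_half_divide(1)) simp
  finally have w_small: "L2_norm P (\<lambda>x. B.proj (mu x) - w x) \<le> e / 2" .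
  have mw: "L2_norm P (\<lambda>x. mu x - w x) < e"
    using L2_norm_triangle[OF R RwL] RB w_small by simp
  have "norm (L2_norm P (\<lambda>x. mu x - a n x) - 0) < e" if n: "n \<ge> N0" for n
  proof -
    have "w x = (\<Sum>i\<in>{i \<in> J. i < n}. inner (h i) (phi x) *\<^sub>R (\<Sum>b\<in>B. inner (h i) (v b) *\<^sub>R b))" for x
    proof -
      have "w x = (\<Sum>b\<in>B. \<Sum>i\<in>{i \<in> J. i < n}. (inner (h i) (v b) * inner (h i) (phi x)) *\<^sub>R b)"
        unfolding w_def
      proof (rule sum.cong[OF refl])
        fix b assume "b \<in> B"
        then have "N b \<le> n" using N0 n order_trans by blast
        from stage_expansion[OF v this]
        show "inner (v b) (phi x) *\<^sub>R b = (\<Sum>i\<in>{i \<in> J. i < n}. (inner (h i) (v b) * inner (h i) (phi x)) *\<^sub>R b)"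
          by (simp add: scaleR_sum_left)
      qed
      also have "\<dots> = (\<Sum>i\<in>{i \<in> J. i < n}. \<Sum>b\<in>B. (inner (h i) (v b) * inner (h i) (phi x)) *\<^sub>R b)"
        by (rule sum.swap)
      finally show ?thesis by (simp add: scaleR_sum_right mult.commute)
    qed
    then have "L2_norm P (\<lambda>x. mu x - a n x) \<le> L2_norm P (\<lambda>x. mu x - w x)"
      using a_minimal[of n "\<lambda>i. \<Sum>b\<in>B. inner (h i) (v b) *\<^sub>R b"] by simp
    then show ?thesis using mw by simp
  qed
  then show "\<exists>N. \<forall>n\<ge>N. norm (L2_norm P (\<lambda>x. mu x - a n x) - 0) < e" by blast
qed

end

section \<open>Reproducing kernel Hilbert spaces\<close>

lemma feature_map_reproduces:
  fixes ev :: "'h::{real_inner, banach} \<Rightarrow> 'x \<Rightarrow> real"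
  assumes rkhs: "is_rkhs D k ev" and x: "x \<in> D"
  shows "inner f (feature_map D k ev x) = ev f x"
    and "y \<in> D \<Longrightarrow> ev (feature_map D k ev x) y = k x y"
proof -
  obtain p where p: "\<forall>y\<in>D. ev p y = k x y" "\<forall>f. inner f p = ev f x"
    using rkhs x unfolding is_rkhs_def by blast
  have inj: "\<And>f g. \<forall>x\<in>D. ev f x = ev g x \<Longrightarrow> f = g" using rkhs unfolding is_rkhs_def by blast
  have "feature_map D k ev x = p"
    unfolding feature_map_def
  proof (rule the_equality, rule p(1))
    fix q assume "\<forall>y\<in>D. ev q y = k x y"
    then show "q = p" using p(1) by (intro inj) simp
  qed
  then show "inner f (feature_map D k ev x) = ev f x"
    and "y \<in> D \<Longrightarrow> ev (feature_map D k ev x) y = k x y"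
    using p by auto
qed

text \<open>A vector orthogonal to all features evaluates to zero everywhere.\<close>

lemma feature_map_span_dense:
  fixes ev :: "'h::{real_inner, banach} \<Rightarrow> 'x \<Rightarrow> real"
  assumes rkhs: "is_rkhs D k ev"
  shows "closure (span (feature_map D k ev ` D)) = UNIV"
proof (rule closure_subspace_UNIV_if_orthogonal_trivial[OF subspace_span])
  fix u assume u: "\<And>s. s \<in> span (feature_map D k ev ` D) \<Longrightarrow> inner u s = 0"
  have inj: "\<And>f g. \<forall>x\<in>D. ev f x = ev g x \<Longrightarrow> f = g" using rkhs unfolding is_rkhs_def by blast
  have "ev u x = ev 0 x" if "x \<in> D" for x
  proof -
    have "feature_map D k ev x \<in> span (feature_map D k ev ` D)" using that by (intro span_base imageI)
    from u[OF this] show ?thesis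
      using feature_map_reproduces(1)[OF rkhs that, of u] feature_map_reproduces(1)[OF rkhs that, of 0] by simp
  qed
  then show "u = 0" by (intro inj) simp
qed

text \<open>On features the inner product is the kernel, whose sections are measurable. Density of their span
gives weak measurability, and separability of the space makes it measurability.\<close>

lemma feature_map_measurable:
  fixes ev :: "'h::{real_inner, banach, second_countable_topology} \<Rightarrow> 'x \<Rightarrow> real"
  assumes rkhs: "is_rkhs (space N) k ev" and k: "\<forall>x\<in>space N. k x \<in> borel_measurable N"
  shows "feature_map (space N) k ev \<in> borel_measurable N"
proof (rule borel_measurable_if_weakly_measurable)
  fix u
  show "(\<lambda>x. inner u (feature_map (space N) k ev x)) \<in> borel_measurable N"
  proof (rule measurable_inner_if_dense[OF feature_map_span_dense[OF rkhs]])
    fix b assume "b \<in> feature_map (space N) k ev ` space N"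
    then obtain z where z: "z \<in> space N" "b = feature_map (space N) k ev z" by blast
    have "k z \<in> borel_measurable N" using k z(1) by blast
    also have "?this \<longleftrightarrow> (\<lambda>x. inner b (feature_map (space N) k ev x)) \<in> borel_measurable N"
      by (rule measurable_cong) (simp add: z feature_map_reproduces[OF rkhs])
    finally show "(\<lambda>x. inner b (feature_map (space N) k ev x)) \<in> borel_measurable N" .
  qed
qed

section \<open>Regression in a finite-dimensional subspace\<close>

text \<open>The reproducing kernel spaces enter the regression problem only through their feature maps: two
square-integrable Hilbert-space valued functions such that no nonzero \<open>inner u \<circ> phi\<close> vanishes almost
everywhere.\<close>

locale cond_mean_regression = regular_conditional M MX X MY Y K
  for M :: "'w measure" and MX :: "'x measure" and X :: "'w \<Rightarrow> 'x"
    and MY :: "'y measure" and Y :: "'w \<Rightarrow> 'y" and K :: "'x \<Rightarrow> 'y measure" +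
  fixes phi :: "'x \<Rightarrow> 'h::{real_inner, banach, second_countable_topology}"
    and psi :: "'y \<Rightarrow> 'g::{real_inner, banach, second_countable_topology}"
  assumes phi [measurable]: "phi \<in> borel_measurable MX" and psi [measurable]: "psi \<in> borel_measurable MY"
    and moment: "integrable M (\<lambda>\<omega>. (norm (phi (X \<omega>)))\<^sup>2 + (norm (psi (Y \<omega>)))\<^sup>2)"
    and nondegenerate: "\<And>u. AE x in PX. inner u (phi x) = 0 \<Longrightarrow> u = 0"
begin

abbreviation CX :: "'h \<Rightarrow>\<^sub>L 'h" where
  "CX \<equiv> uncentred_cov M (\<lambda>\<omega>. phi (X \<omega>)) (\<lambda>\<omega>. phi (X \<omega>))"
abbreviation CXY :: "'g \<Rightarrow>\<^sub>L 'h" where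
  "CXY \<equiv> uncentred_cov M (\<lambda>\<omega>. phi (X \<omega>)) (\<lambda>\<omega>. psi (Y \<omega>))"
abbreviation CYX :: "'h \<Rightarrow>\<^sub>L 'g" where
  "CYX \<equiv> uncentred_cov M (\<lambda>\<omega>. psi (Y \<omega>)) (\<lambda>\<omega>. phi (X \<omega>))"
abbreviation mu :: "'x \<Rightarrow> 'g" where
  "mu \<equiv> cond_mean_embedding MX K psi"

lemma phi_X_L2: "(\<lambda>\<omega>. phi (X \<omega>)) \<in> L2_space M"
proof -
  have "integrable M (\<lambda>\<omega>. (norm (phi (X \<omega>)))\<^sup>2)"
  proof (rule Bochner_Integration.integrable_bound[OF moment])
    show "(\<lambda>\<omega>. (norm (phi (X \<omega>)))\<^sup>2) \<in> borel_measurable M" by measurable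
  qed simp
  then show ?thesis by (simp add: L2_space_def)
qed

lemma psi_Y_L2: "(\<lambda>\<omega>. psi (Y \<omega>)) \<in> L2_space M"
proof -
  have "integrable M (\<lambda>\<omega>. (norm (psi (Y \<omega>)))\<^sup>2)"
  proof (rule Bochner_Integration.integrable_bound[OF moment])
    show "(\<lambda>\<omega>. (norm (psi (Y \<omega>)))\<^sup>2) \<in> borel_measurable M" by measurable
  qed simp
  then show ?thesis by (simp add: L2_space_def)
qed

lemma phi_L2: "phi \<in> L2_space PX"
  using L2_spaceD(2)[OF phi_X_L2] by (simp add: L2_space_def integrable_distr_eq)

lemmas mu_L2 = cond_mean_embedding_L2(1)[OF psi psi_Y_L2]

lemma inner_mu:
  assumes "x \<in> finite_cond_moment MX K psi"
  shows "inner g (mu x) = (\<integral>y. inner g (psi y) \<partial>K x)"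
  using assms cond_mean_embedding_L2(3)[OF psi psi_Y_L2 assms]
  by (simp add: cond_mean_embedding_def)

lemma inner_CX: "inner v (blinfun_apply CX u) = (\<integral>x. inner v (phi x) * inner u (phi x) \<partial>PX)"
  by (simp add: inner_uncentred_cov[OF finite_measure_axioms phi_X_L2 phi_X_L2] integral_distr)

text \<open>Conditioning on \<open>X\<close> replaces \<open>psi (Y \<omega>)\<close> by its conditional mean: the cross-covariance only sees \<open>mu\<close>.
The value of \<open>mu\<close> outside the set of finite conditional moments is immaterial, as this set has full
measure.\<close>

lemma inner_CXY: "inner v (blinfun_apply CXY g) = (\<integral>x. inner v (phi x) * inner g (mu x) \<partial>PX)"
proof -
  define F where "F = (\<lambda>p. inner v (phi (fst p)) * inner g (psi (snd p)))"
  have F: "F \<in> borel_measurable (MX \<Otimes>\<^sub>M MY)" unfolding F_def by measurable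
  have int: "integrable M (\<lambda>\<omega>. F (X \<omega>, Y \<omega>))"
    unfolding F_def fst_conv snd_conv
    by (intro L2_integrable_mult L2_space_inner phi_X_L2 psi_Y_L2)
  have "inner v (blinfun_apply CXY g) = (\<integral>\<omega>. F (X \<omega>, Y \<omega>) \<partial>M)"
    by (simp add: inner_uncentred_cov[OF finite_measure_axioms phi_X_L2 psi_Y_L2] F_def)
  also have "\<dots> = (\<integral>x. \<integral>y. F (x, y) \<partial>K x \<partial>PX)" by (rule integral_disintegration[OF F int])
  also have "\<dots> = (\<integral>x. inner v (phi x) * inner g (mu x) \<partial>PX)"
  proof (rule integral_cong_AE)
    show "(\<lambda>x. \<integral>y. F (x, y) \<partial>K x) \<in> borel_measurable PX" by (rule measurable_integral_K[OF F])
    show "(\<lambda>x. inner v (phi x) * inner g (mu x)) \<in> borel_measurable PX"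
      using L2_spaceD(1)[OF mu_L2] by measurable
    show "AE x in PX. (\<integral>y. F (x, y) \<partial>K x) = inner v (phi x) * inner g (mu x)"
      using cond_mean_embedding_L2(2)[OF psi psi_Y_L2] by eventually_elim (simp add: F_def inner_mu)
  qed
  finally show ?thesis .
qed

lemma inner_CXY_left: "inner (blinfun_apply CXY g) u = inner g (blinfun_apply CYX u)"
  by (simp add: inner_commute[of _ u] mult.commute
      inner_uncentred_cov[OF finite_measure_axioms phi_X_L2 psi_Y_L2]
      inner_uncentred_cov[OF finite_measure_axioms psi_Y_L2 phi_X_L2])

lemma linear_CX: "linear (blinfun_apply CX)"
  by (rule bounded_linear.linear) (rule blinfun.bounded_linear_right)

lemma CX_symmetric: "inner (blinfun_apply CX u) v = inner u (blinfun_apply CX v)"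
  by (simp add: inner_commute[of _ v] inner_CX mult.commute)

lemma CX_definite: assumes "inner u (blinfun_apply CX u) = 0" shows "u = 0"
proof (rule nondegenerate)
  have int: "integrable PX (\<lambda>x. inner u (phi x) * inner u (phi x))"
    by (intro L2_integrable_mult L2_space_inner phi_L2)
  have "AE x in PX. inner u (phi x) * inner u (phi x) = 0"
    using assms integral_nonneg_eq_0_iff_AE[OF int] by (simp add: inner_CX)
  then show "AE x in PX. inner u (phi x) = 0" by simp
qed

text \<open>
The compressed normal equation \<open>A (R g) = proj (CXY g)\<close> says that \<open>inner (R g) \<circ> phi\<close> is the
\<open>L\<^sup>2\<close>-projection of \<open>inner g \<circ> mu\<close> onto the functions \<open>inner v \<circ> phi\<close> with \<open>v\<close> in \<open>V\<close>.\<close>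

context
  fixes I :: "'i set" and e :: "'i \<Rightarrow> 'h" and A :: "'h \<Rightarrow> 'h" and R :: "'g \<Rightarrow> 'h"
  assumes onb: "finite_orthonormal I e"
    and A_eq: "A = (\<lambda>u. finite_orthonormal.proj I e (blinfun_apply CX (finite_orthonormal.proj I e u)))"
    and R_eq: "R = (\<lambda>g. pinv A (finite_orthonormal.proj I e (blinfun_apply CXY g)))"
begin

interpretation finite_orthonormal I e by (rule onb)

lemma pinv_A:
  assumes "y \<in> V"
  shows "pinv A y \<in> V" "A (pinv A y) = y"
  by (rule pinv_compression[OF linear_CX _ A_eq assms], erule CX_definite)+

lemma R_in_span: "R g \<in> V" and A_R: "A (R g) = proj (blinfun_apply CXY g)"
  unfolding R_eq by (rule pinv_A[OF proj_in_span])+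

text \<open>\<open>adjoint\<close> chooses some adjoint if there is one. Since \<open>A\<close> is symmetric, \<open>u \<mapsto> CYX (pinv A (proj u))\<close> is
one.\<close>

lemma adjoint_R: "inner (R g) u = inner g (adjoint R u)"
proof -
  have wit: "inner (R g) u = inner g (blinfun_apply CYX (pinv A (proj u)))" for g u
  proof -
    define z where "z = pinv A (proj u)"
    have z: "z \<in> V" "A z = proj u" unfolding z_def by (rule pinv_A[OF proj_in_span])+
    have "inner (R g) u = inner (R g) (A z)"
      using inner_span_proj[OF R_in_span, of g u] z(2) by simp
    also have "\<dots> = inner (R g) (blinfun_apply CX z)"
      using inner_span_proj[OF R_in_span] by (simp add: A_eq proj_eq[OF z(1)])
    also have "\<dots> = inner (blinfun_apply CX (R g)) z" by (simp add: CX_symmetric)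
    also have "\<dots> = inner (A (R g)) z"
      by (simp add: A_eq proj_eq[OF R_in_span] inner_proj_left proj_eq[OF z(1)])
    also have "\<dots> = inner (blinfun_apply CXY g) z"
      by (simp add: A_R inner_proj_left proj_eq[OF z(1)])
    finally show ?thesis by (simp add: inner_CXY_left z_def)
  qed
  have "adjoint R = (\<lambda>u. blinfun_apply CYX (pinv A (proj u)))"
    by (rule adjoint_unique) (use wit in blast)
  then show ?thesis using wit by simp
qed

lemma adjoint_R_expansion: "adjoint R u = (\<Sum>i\<in>I. inner (e i) u *\<^sub>R adjoint R (e i))"
proof -
  have "inner g (adjoint R u) = inner g (\<Sum>i\<in>I. inner (e i) u *\<^sub>R adjoint R (e i))" for g
  proof -
    have "inner g (adjoint R u) = inner (R g) (proj u)"
      using inner_span_proj[OF R_in_span] by (simp add: adjoint_R[symmetric])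
    also have "\<dots> = (\<Sum>i\<in>I. inner (e i) u * inner (R g) (e i))"
      by (simp add: proj_def inner_sum_right)
    finally show ?thesis by (simp add: inner_sum_right adjoint_R)
  qed
  then show ?thesis by (rule iffD1[OF vector_eq_ldot, OF allI])
qed

lemma residual_orthogonal:
  assumes v: "v \<in> V"
  shows "(\<integral>x. inner v (phi x) * inner g (mu x - adjoint R (phi x)) \<partial>PX) = 0"
proof -
  have "(\<integral>x. inner v (phi x) * inner g (mu x - adjoint R (phi x)) \<partial>PX)
      = (\<integral>x. inner v (phi x) * inner g (mu x) - inner v (phi x) * inner (R g) (phi x) \<partial>PX)"
    by (simp add: inner_diff_right adjoint_R right_diff_distrib)
  also have "\<dots> = inner v (blinfun_apply CXY g) - inner v (blinfun_apply CX (R g))"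
    unfolding inner_CX inner_CXY
    by (intro Bochner_Integration.integral_diff L2_integrable_mult L2_space_inner phi_L2 mu_L2)
  also have "\<dots> = inner v (A (R g)) - inner v (blinfun_apply CX (R g))"
    by (simp add: A_R inner_span_proj[OF v])
  also have "\<dots> = 0"
    using inner_span_proj[OF v] by (simp add: A_eq proj_eq[OF R_in_span])
  finally show ?thesis .
qed

end

end

section \<open>Convergence of the conditional mean embedding approximations\<close>

theorem theorem5p4:
  fixes M :: "'w measure" and MX :: "'x measure" and MY :: "'y measure"
    and X :: "'w \<Rightarrow> 'x" and Y :: "'w \<Rightarrow> 'y"
    and k :: "'x \<Rightarrow> 'x \<Rightarrow> real" and l :: "'y \<Rightarrow> 'y \<Rightarrow> real"
    and evH :: "'h::{real_inner, banach, second_countable_topology} \<Rightarrow> 'x \<Rightarrow> real"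
    and evG :: "'g::{real_inner, banach, second_countable_topology} \<Rightarrow> 'y \<Rightarrow> real"
    and K :: "'x \<Rightarrow> 'y measure"
    and phi :: "'x \<Rightarrow> 'h" and psi :: "'y \<Rightarrow> 'g"
    and PX :: "'x measure"
    and CX :: "'h \<Rightarrow>\<^sub>L 'h" and uCX :: "'h \<Rightarrow>\<^sub>L 'h" and uCY :: "'g \<Rightarrow>\<^sub>L 'g"
    and uCXY :: "'g \<Rightarrow>\<^sub>L 'h" and uCYX :: "'h \<Rightarrow> 'g"
    and mu :: "'x \<Rightarrow> 'g" and f :: "'g \<Rightarrow> 'x \<Rightarrow> real"
    and d :: enat and J :: "nat set" and h :: "nat \<Rightarrow> 'h"
    and Hn :: "nat \<Rightarrow> 'h set" and P :: "nat \<Rightarrow> 'g \<times> 'h \<Rightarrow> 'g \<times> 'h"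
    and uC :: "'g \<times> 'h \<Rightarrow> 'g \<times> 'h" and uCn :: "nat \<Rightarrow> 'g \<times> 'h \<Rightarrow> 'g \<times> 'h"
    and uCXn :: "nat \<Rightarrow> 'h \<Rightarrow> 'h" and uCXYn :: "nat \<Rightarrow> 'g \<Rightarrow> 'h" and uCYXn :: "nat \<Rightarrow> 'h \<Rightarrow> 'g"
    and uh :: "nat \<Rightarrow> 'g \<Rightarrow> 'h" and umu :: "nat \<Rightarrow> 'x \<Rightarrow> 'g"
  assumes prob: "prob_space M"
    and Y_borel: "borel_space MY"
    and k_kernel: "sym_pd_kernel (space MX) k"
    and l_kernel: "sym_pd_kernel (space MY) l"
    and k_meas: "\<forall>x\<in>space MX. k x \<in> borel_measurable MX"
    and l_meas: "\<forall>y\<in>space MY. l y \<in> borel_measurable MY"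
    and H_rkhs: "is_rkhs (space MX) k evH"
    and G_rkhs: "is_rkhs (space MY) l evG"
    and phi_eq: "phi = feature_map (space MX) k evH"
    and psi_eq: "psi = feature_map (space MY) l evG"
    and X_rv: "X \<in> measurable M MX"
    and Y_rv: "Y \<in> measurable M MY"
    and PX_eq: "PX = distr M MX X"
    and K_rcd: "regular_cond_distr M MX X MY Y K"
    and moment: "integrable M (\<lambda>\<omega>. (norm (phi (X \<omega>)))\<^sup>2 + (norm (psi (Y \<omega>)))\<^sup>2)"
    and H_inj: "\<forall>u. (AE x in PX. evH u x = 0) \<longleftrightarrow> u = 0"
    and CX_eq: "CX = centred_cov M (\<lambda>\<omega>. phi (X \<omega>)) (\<lambda>\<omega>. phi (X \<omega>))"
    and uCX_eq: "uCX = uncentred_cov M (\<lambda>\<omega>. phi (X \<omega>)) (\<lambda>\<omega>. phi (X \<omega>))"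
    and uCY_eq: "uCY = uncentred_cov M (\<lambda>\<omega>. psi (Y \<omega>)) (\<lambda>\<omega>. psi (Y \<omega>))"
    and uCXY_eq: "uCXY = uncentred_cov M (\<lambda>\<omega>. phi (X \<omega>)) (\<lambda>\<omega>. psi (Y \<omega>))"
    and uCYX_eq: "uCYX = adjoint (blinfun_apply uCXY)"
    and mu_eq: "mu = cond_mean_embedding MX K psi"
    and f_eq: "f = cond_exp_fun MX K psi evG"
    and J_eq: "J = {i. enat i < d}"
    and h_eigenbasis: "eigenbasis_on J h (blinfun_apply CX)"
    and Hn_eq: "\<And>n. Hn n = span (h ` {i \<in> J. i < n})"
    and P_eq: "\<And>n. P n = orth_proj (UNIV \<times> Hn n)"
    and uC_eq: "uC = block_op (blinfun_apply uCY) uCYX (blinfun_apply uCXY) (blinfun_apply uCX)"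
    and uCn_eq: "\<And>n. uCn n = P n \<circ> uC \<circ> P n"
    and uCXn_eq: "\<And>n. uCXn n = (\<lambda>u. snd (uCn n (0, u)))"
    and uCXYn_eq: "\<And>n. uCXYn n = (\<lambda>g. snd (uCn n (g, 0)))"
    and uCYXn_eq: "\<And>n. uCYXn n = (\<lambda>u. fst (uCn n (0, u)))"
    and uh_eq: "\<And>n. uh n = (\<lambda>g. pinv (uCXn n) (uCXYn n g))"
    and umu_eq: "\<And>n. umu n = (\<lambda>x. adjoint (uh n) (phi x))"
  shows
    "(\<forall>n. uCn n = block_op (blinfun_apply uCY) (uCYXn n) (uCXYn n) (uCXn n))
   \<and> (\<forall>n. range (uCXYn n) \<subseteq> range (uCXn n))
   \<and> (\<forall>n g. uCXYn n g \<in> pinv_dom (uCXn n))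
   \<and> (\<forall>y\<in>space MY. \<forall>u.
        evH u \<in> L2_space PX
      \<and> (\<lambda>x. evG (mu x) y) \<in> L2_space PX
      \<and> (\<forall>n. (\<lambda>x. evG (umu n x) y) \<in> L2_space PX)
      \<and> (\<lambda>n. L2_inner PX (evH u) (\<lambda>x. evG (umu n x) y))
           \<longlonglongrightarrow> L2_inner PX (evH u) (\<lambda>x. evG (mu x) y))
   \<and> (L2_universal MX k evH
        \<or> L2_dense PX (range evH)
        \<or> (\<forall>g. f g \<in> L2_closure PX (range evH))
        \<or> (\<forall>y\<in>space MY. f (psi y) \<in> L2_closure PX (range evH))
      \<longrightarrow> (\<forall>n. (\<lambda>\<omega>. umu n (X \<omega>) - mu (X \<omega>)) \<in> L2_space M)
        \<and> (\<lambda>n. L2_norm M (\<lambda>\<omega>. umu n (X \<omega>) - mu (X \<omega>))) \<longlonglongrightarrow> 0)"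
proof -
  interpret M: prob_space M by (rule prob)
  have phi_rep: "inner u (phi x) = evH u x" if "x \<in> space MX" for u x
    unfolding phi_eq by (rule feature_map_reproduces(1)[OF H_rkhs that])
  have psi_rep: "inner g (psi y) = evG g y" if "y \<in> space MY" for g y
    unfolding psi_eq by (rule feature_map_reproduces(1)[OF G_rkhs that])
  have sp: "space PX = space MX" "sets PX = sets MX" by (simp_all add: PX_eq)
  interpret R: cond_mean_regression M MX X MY Y K phi psi
  proof
    show "phi \<in> borel_measurable MX"
      unfolding phi_eq by (rule feature_map_measurable[OF H_rkhs k_meas])
    show "psi \<in> borel_measurable MY"
      unfolding psi_eq by (rule feature_map_measurable[OF G_rkhs l_meas])
    fix u assume "AE x in distr M MX X. inner u (phi x) = 0"
    then have "AE x in PX. evH u x = 0"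
      unfolding PX_eq[symmetric] using AE_space
      by eventually_elim (simp add: sp phi_rep[symmetric])
    then show "u = 0" using H_inj by blast
  qed (rule X_rv Y_rv K_rcd moment)+
  note phi_L2 = R.phi_L2[folded PX_eq] and mu_L2 = R.mu_L2[folded PX_eq mu_eq]
  define I where "I = (\<lambda>n. {i \<in> J. i < n})"
  have I_eq: "{i \<in> J. i < n} = I n" for n by (simp add: I_def)
  have basis: "complete_orthonormal_on J h" using h_eigenbasis by (simp add: eigenbasis_on_def)
  have orth: "finite_orthonormal (I n) h" for n
    using basis by unfold_locales (auto simp: complete_orthonormal_on_def I_def)
  define Q where "Q = (\<lambda>n. finite_orthonormal.proj (I n) h)"
  have Q_linear: "linear (Q n)" for n
    unfolding Q_def by (rule finite_orthonormal.linear_proj[OF orth])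
  have P_apply: "P n (g, u) = (g, Q n u)" for n g u
    unfolding P_eq Hn_eq Q_def I_eq by (rule finite_orthonormal.orth_proj_Times[OF orth])
  have uCYX: "uCYX = blinfun_apply R.CYX"
    unfolding uCYX_eq uCXY_eq by (rule adjoint_unique) (simp add: R.inner_CXY_left)
  have uCn_apply: "uCn n (g, u) = (uCY g + uCYX (Q n u), Q n (uCXY g + uCX (Q n u)))" for n g u
    by (simp add: uCn_eq uC_eq block_op_def P_apply)
  have uCXn: "uCXn n = (\<lambda>u. Q n (blinfun_apply uCX (Q n u)))" for n
    by (simp add: uCXn_eq uCn_apply blinfun.zero_right)
  have uCXYn: "uCXYn n = (\<lambda>g. Q n (blinfun_apply uCXY g))" for n
    by (simp add: uCXYn_eq uCn_apply linear_0[OF Q_linear] blinfun.zero_right)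
  have uCYXn: "uCYXn n = (\<lambda>u. uCYX (Q n u))" for n
    by (simp add: uCYXn_eq uCn_apply blinfun.zero_right)
  have block: "uCn n = block_op (blinfun_apply uCY) (uCYXn n) (uCXYn n) (uCXn n)" for n
    by (rule ext) (auto simp: block_op_def uCn_apply uCXn uCXYn uCYXn linear_add[OF Q_linear])

  note A_eq = uCXn[unfolded uCX_eq Q_def]
  have uh: "uh n = (\<lambda>g. pinv (uCXn n) (finite_orthonormal.proj (I n) h (blinfun_apply R.CXY g)))" for n
    by (simp add: uh_eq uCXYn uCXY_eq Q_def)
  have span_range: "uCXYn n g \<in> span (h ` I n)" for n g
    unfolding uCXYn Q_def by (rule finite_orthonormal.proj_in_span[OF orth])
  have range_uCXn: "range (uCXn n) = span (h ` I n)" for n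
    by (rule finite_orthonormal.range_compression[OF orth R.linear_CX R.CX_definite A_eq])
  have dom: "uCXYn n g \<in> pinv_dom (uCXn n)" for n g
    using finite_orthonormal.span_le_pinv_dom[OF orth R.linear_CX R.CX_definite A_eq] span_range
    by blast

  \<comment> \<open>The approximations are least-squares projections with these coefficients.\<close>
  define c where "c = (\<lambda>n i. adjoint (uh n) (h i))"
  have umu_sum: "umu n x = (\<Sum>i\<in>{i \<in> J. i < n}. inner (h i) (phi x) *\<^sub>R c n i)" for n x
    unfolding umu_eq c_def I_eq
    by (rule R.adjoint_R_expansion[OF orth A_eq uh])
  interpret L: least_squares_sequence PX phi mu J h c umu
  proof
    show "umu n x = (\<Sum>i\<in>{i \<in> J. i < n}. inner (h i) (phi x) *\<^sub>R c n i)" for n x by (rule umu_sum)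
    fix n i g assume "i \<in> J" "i < n"
    then have "h i \<in> span (h ` I n)" by (intro span_base) (simp add: I_def)
    from R.residual_orthogonal[OF orth A_eq uh this, of g]
    show "(\<integral>x. inner (h i) (phi x) * inner g (mu x - umu n x) \<partial>PX) = 0"
      by (simp add: mu_eq PX_eq umu_eq)
  qed (rule mu_L2 phi_L2 basis)+

  have evG_inner: "(\<lambda>x. evG (v x) y) = (\<lambda>x. inner (psi y) (v x))" if "y \<in> space MY" for v :: "'x \<Rightarrow> 'g" and y
    by (simp add: psi_rep[OF that, symmetric] inner_commute)
  have evH_L2: "evH u \<in> L2_space PX" for u
    using L2_space_inner(1)[OF phi_L2, of u]
    by (rule L2_space_cong[THEN iffD1, rotated]) (simp add: sp phi_rep)
  have L2_inner_eq: "L2_inner PX (evH u) w = (\<integral>x. inner u (phi x) * w x \<partial>PX)" for u w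
    unfolding L2_inner_def by (rule Bochner_Integration.integral_cong) (simp_all add: sp phi_rep)
  have weak: "evH u \<in> L2_space PX
      \<and> (\<lambda>x. evG (mu x) y) \<in> L2_space PX
      \<and> (\<forall>n. (\<lambda>x. evG (umu n x) y) \<in> L2_space PX)
      \<and> (\<lambda>n. L2_inner PX (evH u) (\<lambda>x. evG (umu n x) y)) \<longlonglongrightarrow> L2_inner PX (evH u) (\<lambda>x. evG (mu x) y)"
    if "y \<in> space MY" for y u
    unfolding evG_inner[OF that] L2_inner_eq
    using evH_L2 L2_space_inner(1)[OF mu_L2] L2_space_inner(1)[OF L.a_L2] L.weak_convergence by blast

  have f_inner: "f g x = inner g (mu x)" if x: "x \<in> space MX" for g x
  proof (cases "x \<in> finite_cond_moment MX K psi")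
    case True
    have "f g x = (\<integral>y. evG g y \<partial>K x)" using True by (simp add: f_eq cond_exp_fun_def)
    also have "\<dots> = (\<integral>y. inner g (psi y) \<partial>K x)"
      by (rule Bochner_Integration.integral_cong)
        (simp_all add: psi_rep sets_eq_imp_space_eq[OF R.sets_K[OF x]])
    also have "\<dots> = inner g (mu x)" by (simp add: mu_eq R.inner_mu[OF True])
    finally show ?thesis .
  qed (simp add: f_eq cond_exp_fun_def mu_eq cond_mean_embedding_def)
  have f_L2: "f g \<in> L2_space PX" for g
    using L2_space_inner(1)[OF mu_L2, of g]
    by (rule L2_space_cong[THEN iffD1, rotated]) (simp add: sp f_inner)

  have strong: "(\<forall>n. (\<lambda>\<omega>. umu n (X \<omega>) - mu (X \<omega>)) \<in> L2_space M)
      \<and> (\<lambda>n. L2_norm M (\<lambda>\<omega>. umu n (X \<omega>) - mu (X \<omega>))) \<longlonglongrightarrow> 0"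
    if cond: "L2_universal MX k evH \<or> L2_dense PX (range evH)
        \<or> (\<forall>g. f g \<in> L2_closure PX (range evH))
        \<or> (\<forall>y\<in>space MY. f (psi y) \<in> L2_closure PX (range evH))"
  proof -
    have PX_prob: "prob_space PX" unfolding PX_eq by (rule M.prob_space_distr[OF X_rv])
    \<comment> \<open>Each of the four conditions implies the last one; \<open>L\<^sup>2\<close>-universality is used at the law of \<open>X\<close>.\<close>
    have f_closure: "f (psi y) \<in> L2_closure PX (range evH)" if y: "y \<in> space MY" for y
      using cond
    proof (elim disjE)
      assume "L2_universal MX k evH"
      then have "L2_dense PX (range evH)" using PX_prob sp(2) by (simp add: L2_universal_def)
      then show ?thesis using f_L2 by (simp add: L2_dense_def)
    next
      assume "L2_dense PX (range evH)"
      then show ?thesis using f_L2 by (simp add: L2_dense_def)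
    qed (use y in blast)+
    have gen: "\<exists>u. L2_norm PX (\<lambda>x. inner g (mu x) - inner u (phi x)) < e"
      if g: "g \<in> psi ` space MY" and e: "e > 0" for g and e :: real
    proof -
      have "f g \<in> L2_closure PX (range evH)" using g f_closure by blast
      then obtain u where u: "L2_norm PX (\<lambda>x. f g x - evH u x) < e"
        unfolding L2_closure_def using e by blast
      have "L2_norm PX (\<lambda>x. f g x - evH u x) = L2_norm PX (\<lambda>x. inner g (mu x) - inner u (phi x))"
        by (rule L2_norm_cong) (simp add: sp f_inner phi_rep)
      then show ?thesis using u by auto
    qed
    have dense: "closure (span (psi ` space MY)) = UNIV"
      unfolding psi_eq by (rule feature_map_span_dense[OF G_rkhs])
    have lim: "(\<lambda>n. L2_norm PX (\<lambda>x. mu x - umu n x)) \<longlonglongrightarrow> 0"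
      by (rule L.strong_convergence) (rule L2_approximable_all_if_dense[OF mu_L2 phi_L2 dense gen])
    have mu_m [measurable]: "mu \<in> borel_measurable MX"
      using L2_spaceD(1)[OF mu_L2] by (simp add: PX_eq)
    have umu_m [measurable]: "umu n \<in> borel_measurable MX" for n
      using L2_spaceD(1)[OF L.a_L2] by (simp add: PX_eq)
    have eq: "L2_norm M (\<lambda>\<omega>. umu n (X \<omega>) - mu (X \<omega>)) = L2_norm PX (\<lambda>x. mu x - umu n x)" for n
      unfolding L2_norm_def PX_eq by (subst integral_distr) (simp_all add: norm_minus_commute X_rv)
    have "(\<lambda>\<omega>. umu n (X \<omega>) - mu (X \<omega>)) \<in> L2_space M" for n
      using L2_spaceD(2)[OF L2_space_diff[OF L.a_L2 mu_L2], of n] X_rv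
      by (simp add: L2_space_def PX_eq integrable_distr_eq)
    then show ?thesis using lim by (simp add: eq)
  qed
  show ?thesis
    using block span_range range_uCXn dom weak strong by blast
qed

end
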